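(* Let $\alpha$ be an automorphism of a unital $C^*$-algebra $A$ and let $A^\alpha=\{a\in A\mid \alpha(a)=a\}$ be its fixed-point subalgebra. Then the following five statements are equivalent: (i) Every bounded linear functional on $A^\alpha$ has a unique bounded, $\alpha$-invariant linear extension to $A$. (ii) Every state of $A^\alpha$ has a unique $\alpha$-invariant state extension to $A$. (iii) The subspace $A^\alpha+\{a-\alpha(a)\mid a\in A\}$ is norm-dense in $A$. (iv) For every $a\in A$ the sequence of ergodic averages $\frac1n\sum_{k=0}^{n-1}\alpha^k(a)$ converges in norm as $n\to\infty$. (v) $A^\alpha+\overline{\{a-\alpha(a)\mid a\in A\}}=A$, where the closure is in norm. Moreover, (i)–(v) imply: (vi) There exists a unique $\alpha$-invariant conditional expectation $E$ from $A$ onto $A^\alpha$ (i.e. $E\circ\alpha=E$); and when (i)–(v) hold, this $E$ is given by $E(a)=\lim_{n\to\infty}\frac1n\sum_{k=0}^{n-1}\alpha^k(a)$ for all $a\in A$.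
   Context: A conditional expectation from a $C^*$-algebra $A$ onto a $C^*$-subalgebra $B$ is a linear projection of norm one from $A$ onto $B$. A state is a positive linear functional of norm one. *)

theory Defs
  imports "HOL-Analysis.Analysis"
begin

class cstar_algebra = real_normed_algebra_1 + banach +
  fixes cscale :: "complex \<Rightarrow> 'a \<Rightarrow> 'a"  (infixr \<open>*\<^sub>C\<close> 75)
    and cstar :: "'a \<Rightarrow> 'a"
  assumes cscale_of_real: "cscale (complex_of_real r) x = scaleR r x"
    and cscale_add_right: "cscale c (x + y) = cscale c x + cscale c y"
    and cscale_add_left: "cscale (c + d) x = cscale c x + cscale d x"
    and cscale_cscale: "cscale c (cscale d x) = cscale (c * d) x"
    and cscale_one: "cscale 1 x = x"
    and norm_cscale: "norm (cscale c x) = cmod c * norm x"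
    and cscale_mult_left: "cscale c (x * y) = (cscale c x) * y"
    and cscale_mult_right: "cscale c (x * y) = x * (cscale c y)"
    and cstar_cstar: "cstar (cstar x) = x"
    and cstar_add: "cstar (x + y) = cstar x + cstar y"
    and cstar_cscale: "cstar (cscale c x) = cscale (cnj c) (cstar x)"
    and cstar_mult: "cstar (x * y) = cstar y * cstar x"
    and cstar_identity: "norm (cstar x * x) = norm x * norm x"

definition star_automorphism :: "('a::cstar_algebra \<Rightarrow> 'a) \<Rightarrow> bool" where
  "star_automorphism \<alpha> \<longleftrightarrow> bij \<alpha> \<and>
     (\<forall>x y. \<alpha> (x + y) = \<alpha> x + \<alpha> y) \<and>
     (\<forall>c x. \<alpha> (c *\<^sub>C x) = c *\<^sub>C \<alpha> x) \<and>
     (\<forall>x y. \<alpha> (x * y) = \<alpha> x * \<alpha> y) \<and>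
     (\<forall>x. \<alpha> (cstar x) = cstar (\<alpha> x))"

definition fixed_points :: "('a \<Rightarrow> 'a) \<Rightarrow> 'a set" where
  "fixed_points \<alpha> = {a. \<alpha> a = a}"

text \<open>Complex linear functional on a (sub)space S (only the values on S matter).\<close>
definition clinear_on :: "'a::cstar_algebra set \<Rightarrow> ('a \<Rightarrow> complex) \<Rightarrow> bool" where
  "clinear_on S f \<longleftrightarrow> (\<forall>x\<in>S. \<forall>y\<in>S. f (x + y) = f x + f y) \<and>
                       (\<forall>c. \<forall>x\<in>S. f (c *\<^sub>C x) = c * f x)"

definition bounded_on :: "'a::cstar_algebra set \<Rightarrow> ('a \<Rightarrow> complex) \<Rightarrow> bool" where
  "bounded_on S f \<longleftrightarrow> (\<exists>K. \<forall>x\<in>S. cmod (f x) \<le> K * norm x)"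

definition bounded_functional_on :: "'a::cstar_algebra set \<Rightarrow> ('a \<Rightarrow> complex) \<Rightarrow> bool" where
  "bounded_functional_on S f \<longleftrightarrow> clinear_on S f \<and> bounded_on S f"

definition functional_norm_on :: "'a::cstar_algebra set \<Rightarrow> ('a \<Rightarrow> complex) \<Rightarrow> real" where
  "functional_norm_on S f = Sup {cmod (f x) | x. x \<in> S \<and> norm x \<le> 1}"

definition positive_in :: "'a::cstar_algebra set \<Rightarrow> 'a \<Rightarrow> bool" where
  "positive_in S a \<longleftrightarrow> (\<exists>b\<in>S. a = cstar b * b)"

definition state_on :: "'a::cstar_algebra set \<Rightarrow> ('a \<Rightarrow> complex) \<Rightarrow> bool" where
  "state_on S f \<longleftrightarrow> bounded_functional_on S f \<and>
     (\<forall>a\<in>S. positive_in S a \<longrightarrow> Im (f a) = 0 \<and> Re (f a) \<ge> 0) \<and>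
     functional_norm_on S f = 1"

definition conditional_expectation :: "'a::cstar_algebra set \<Rightarrow> ('a \<Rightarrow> 'a) \<Rightarrow> bool" where
  "conditional_expectation B E \<longleftrightarrow>
     (\<forall>x y. E (x + y) = E x + E y) \<and> (\<forall>c x. E (c *\<^sub>C x) = c *\<^sub>C E x) \<and>
     range E = B \<and> (\<forall>b\<in>B. E b = b) \<and>
     (\<exists>K. \<forall>x. norm (E x) \<le> K * norm x) \<and>
     Sup {norm (E x) | x. norm x \<le> 1} = 1"

definition ergodic_avg :: "('a::cstar_algebra \<Rightarrow> 'a) \<Rightarrow> 'a \<Rightarrow> nat \<Rightarrow> 'a" where
  "ergodic_avg \<alpha> a n = scaleR (1 / real n) (\<Sum>k<n. (\<alpha> ^^ k) a)"

end

theory Submission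
  imports Defs
begin

text \<open>Automorphisms are contractive, so the averages are contractions that fix the fixed points and tend
  to \<open>0\<close> on the coboundaries \<open>a - \<alpha> a\<close>; hence (iii), (iv) and (v) are the mean ergodic theorem, and
  composing with the limit projection gives the extensions in (i) and (ii). It preserves positivity because
  the positive cone is closed and a positive fixed point has a fixed square root.

  Conversely, if (iii) fails, Hahn--Banach gives a nonzero invariant functional \<open>g\<close> that vanishes on the
  fixed points, which contradicts (i). It contradicts (ii) as well: \<open>g\<close> may be taken hermitian, and is then
  the difference of two invariant positive functionals. Their existence is again a Hahn--Banach argument,
  whose consistency is checked by averaging. The two functionals agree on the fixed points, so they
  coincide.\<close>

subsection \<open>Elementary identities\<close>

text \<open>The order theory rests on one norm criterion: for selfadjoint \<open>x\<close> and
  \<open>t > 0\<close> with \<open>norm x \<le> t\<close>, \<open>x\<close> is a square of a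
  selfadjoint element iff \<open>norm (t 1 - x) \<le> t\<close>. Its source is an iteration for the
  root of \<open>1 - h\<close> that converges on the whole closed ball
  \<open>norm h \<le> 1\<close>. The criterion makes the positive cone convex and closed;
  conversely, the norm of a positive element can be read off from the order, and this is why
  automorphisms, which preserve the order and \<open>1\<close>, are contractive. The obstacle in
  (ii) is that \<open>state_on\<close> tests the elements \<open>cstar b * b\<close> with
  \<open>b\<close> in the given set. Hahn--Banach only controls squares of selfadjoint elements, so
  the Fukamiya--Kaplansky theorem has to identify the two cones. Since (ii) speaks of invariant
  states only, the positive parts of \<open>g\<close> must be invariant; invariance is therefore
  built into the Hahn--Banach constraints from the start. Uniqueness in (i), (ii) and (vi) has one
  common reason: a bounded invariant map kills the closure of the coboundaries.\<close>

lemma cscale_zero_right [simp]: "c *\<^sub>C (0::'a::cstar_algebra) = 0"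
  using cscale_add_right[of c "0::'a" 0] by simp

lemma cscale_zero_left [simp]: "0 *\<^sub>C (x::'a::cstar_algebra) = 0"
  using cscale_of_real[of 0 x] by simp

lemma cscale_minus_right: "c *\<^sub>C (- x) = - (c *\<^sub>C (x::'a::cstar_algebra))"
  using cscale_add_right[of c x "- x"] by (simp add: eq_neg_iff_add_eq_0 add.commute)

lemma cscale_minus_left: "(- c) *\<^sub>C x = - (c *\<^sub>C (x::'a::cstar_algebra))"
  using cscale_add_left[of c "- c" x] by (simp add: eq_neg_iff_add_eq_0 add.commute)

lemma cscale_diff_right: "c *\<^sub>C (x - y) = c *\<^sub>C x - c *\<^sub>C (y::'a::cstar_algebra)"
  using cscale_add_right[of c x "- y"] by (simp add: cscale_minus_right)

lemma cscale_scaleR: "c *\<^sub>C (r *\<^sub>R x) = r *\<^sub>R (c *\<^sub>C (x::'a::cstar_algebra))"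
  by (simp flip: cscale_of_real add: cscale_cscale mult.commute)

lemma bounded_linear_cscale: "bounded_linear (\<lambda>x::'a::cstar_algebra. c *\<^sub>C x)"
  by (rule bounded_linear_intro[of _ "cmod c"])
    (simp_all add: cscale_add_right cscale_scaleR norm_cscale mult.commute)

lemma cscale_Complex: "c *\<^sub>C (x::'a::cstar_algebra) = Re c *\<^sub>R x + Im c *\<^sub>R (\<i> *\<^sub>C x)"
proof -
  have "c = complex_of_real (Re c) + complex_of_real (Im c) * \<i>"
    by (simp add: complex_eq_iff)
  then have "c *\<^sub>C x = (complex_of_real (Re c) + complex_of_real (Im c) * \<i>) *\<^sub>C x"
    by simp
  also have "\<dots> = Re c *\<^sub>R x + Im c *\<^sub>R (\<i> *\<^sub>C x)"
    by (simp only: cscale_add_left cscale_of_real flip: cscale_cscale)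
  finally show ?thesis .
qed

lemma cstar_zero [simp]: "cstar (0::'a::cstar_algebra) = 0"
  using cstar_add[of "0::'a" 0] by simp

lemma cstar_minus [simp]: "cstar (- x) = - cstar (x::'a::cstar_algebra)"
  using cstar_add[of x "- x"] by (simp add: eq_neg_iff_add_eq_0 add.commute)

lemma cstar_diff: "cstar (x - y) = cstar x - cstar (y::'a::cstar_algebra)"
  using cstar_add[of x "- y"] by simp

lemma cstar_scaleR [simp]: "cstar (r *\<^sub>R x) = r *\<^sub>R cstar (x::'a::cstar_algebra)"
  using cstar_cscale[of "complex_of_real r" x] by (simp add: cscale_of_real)

lemma cstar_one [simp]: "cstar (1::'a::cstar_algebra) = 1"
  by (metis cstar_cstar cstar_mult mult.left_neutral mult.right_neutral)

lemma norm_cstar [simp]: "norm (cstar x) = norm (x::'a::cstar_algebra)"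
proof -
  have le: "norm z \<le> norm (cstar z)" for z :: 'a
  proof (cases "norm z = 0")
    case False
    have "norm z * norm z \<le> norm (cstar z) * norm z"
      by (metis cstar_identity norm_mult_ineq)
    then show ?thesis using False by simp
  qed simp
  show ?thesis using le[of x] le[of "cstar x"] by (simp add: cstar_cstar)
qed

lemma norm_square_selfadjoint:
  "cstar x = x \<Longrightarrow> norm (x * x) = norm x * norm (x::'a::cstar_algebra)"
  using cstar_identity[of x] by simp

lemma bounded_linear_cstar: "bounded_linear (cstar :: 'a::cstar_algebra \<Rightarrow> 'a)"
  by (rule bounded_linear_intro[of _ 1]) (simp_all add: cstar_add)

lemma closed_selfadjoint: "closed {x::'a::cstar_algebra. cstar x = x}"
  by (intro closed_Collect_eq continuous_intros linear_continuous_on[OF bounded_linear_cstar])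

subsection \<open>Square roots\<close>

text \<open>A fixed point \<open>y\<close> of the step satisfies \<open>2 y = h + y * y\<close>,
  that is, \<open>(1 - y) * (1 - y) = 1 - h\<close>.\<close>

primrec sqrt_iter :: "'a::cstar_algebra \<Rightarrow> nat \<Rightarrow> 'a" where
  "sqrt_iter h 0 = 0"
| "sqrt_iter h (Suc n) = (1/2) *\<^sub>R (h + sqrt_iter h n * sqrt_iter h n)"

text \<open>The real sequence obtained from \<open>h = 1\<close> increases to \<open>1\<close> and majorises the
  increments of \<open>sqrt_iter h\<close> whenever \<open>norm h \<le> 1\<close>; so no strict inequality
  \<open>norm h < 1\<close> is needed for convergence.\<close>

primrec sqrt_majorant :: "nat \<Rightarrow> real" where
  "sqrt_majorant 0 = 0"
| "sqrt_majorant (Suc n) = (1/2) * (1 + sqrt_majorant n * sqrt_majorant n)"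

lemma sqrt_majorant_bounds: "0 \<le> sqrt_majorant n" "sqrt_majorant n \<le> 1"
proof -
  have "0 \<le> sqrt_majorant n \<and> sqrt_majorant n \<le> 1"
  proof (induction n)
    case (Suc n)
    then have "sqrt_majorant n * sqrt_majorant n \<le> 1" by (simp add: mult_le_one)
    then show ?case by simp
  qed simp
  then show "0 \<le> sqrt_majorant n" "sqrt_majorant n \<le> 1" by auto
qed

lemma sqrt_majorant_Suc_ge: "sqrt_majorant n \<le> sqrt_majorant (Suc n)"
proof -
  have "0 \<le> (1 - sqrt_majorant n) * (1 - sqrt_majorant n)" by simp
  then show ?thesis by (simp add: algebra_simps)
qed

lemma norm_sqrt_iter_le:
  assumes "norm h \<le> 1"
  shows "norm (sqrt_iter h n) \<le> sqrt_majorant n"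
proof (induction n)
  case (Suc n)
  have "norm (sqrt_iter h n * sqrt_iter h n) \<le> norm (sqrt_iter h n) * norm (sqrt_iter h n)"
    by (rule norm_mult_ineq)
  also have "\<dots> \<le> sqrt_majorant n * sqrt_majorant n"
    using Suc by (intro mult_mono) (auto intro: sqrt_majorant_bounds)
  finally have "norm (h + sqrt_iter h n * sqrt_iter h n) \<le> 1 + sqrt_majorant n * sqrt_majorant n"
    using assms norm_triangle_ineq[of h "sqrt_iter h n * sqrt_iter h n"] by linarith
  then show ?case by simp
qed simp

text \<open>The factorisation \<open>x * x - y * y = x * (x - y) + (x - y) * y\<close> holds in
  noncommutative algebras, and the same identity for the majorant turns the bound into its next
  increment.\<close>

lemma norm_sqrt_iter_step:
  assumes "norm h \<le> 1"
  shows "norm (sqrt_iter h (Suc n) - sqrt_iter h n) \<le> sqrt_majorant (Suc n) - sqrt_majorant n"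
proof (induction n)
  case (Suc n)
  let ?x = "sqrt_iter h (Suc n)" and ?y = "sqrt_iter h n"
  let ?s = "sqrt_majorant (Suc n)" and ?t = "sqrt_majorant n"
  have "sqrt_iter h (Suc (Suc n)) - ?x = (1/2) *\<^sub>R (h + ?x * ?x) - (1/2) *\<^sub>R (h + ?y * ?y)"
    by (simp only: sqrt_iter.simps(2))
  also have "\<dots> = (1/2) *\<^sub>R (?x * (?x - ?y) + (?x - ?y) * ?y)"
    by (simp add: algebra_simps del: sqrt_iter.simps)
  finally have eq: "sqrt_iter h (Suc (Suc n)) - ?x = (1/2) *\<^sub>R (?x * (?x - ?y) + (?x - ?y) * ?y)" .
  have "norm (?x * (?x - ?y)) \<le> norm ?x * norm (?x - ?y)" by (rule norm_mult_ineq)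
  also have "\<dots> \<le> ?s * (?s - ?t)"
    using norm_sqrt_iter_le[OF assms, of "Suc n"] Suc sqrt_majorant_bounds(1)[of "Suc n"]
    by (intro mult_mono) auto
  finally have 1: "norm (?x * (?x - ?y)) \<le> ?s * (?s - ?t)" .
  have "norm ((?x - ?y) * ?y) \<le> norm (?x - ?y) * norm ?y" by (rule norm_mult_ineq)
  also have "\<dots> \<le> (?s - ?t) * ?t"
    using norm_sqrt_iter_le[OF assms, of n] Suc sqrt_majorant_Suc_ge[of n]
    by (intro mult_mono) auto
  finally have 2: "norm ((?x - ?y) * ?y) \<le> (?s - ?t) * ?t" .
  have "norm (?x * (?x - ?y) + (?x - ?y) * ?y) \<le> ?s * (?s - ?t) + (?s - ?t) * ?t"
    using 1 2 norm_triangle_ineq[of "?x * (?x - ?y)" "(?x - ?y) * ?y"] by linarith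
  also have "\<dots> = 2 * (sqrt_majorant (Suc (Suc n)) - ?s)"
    by (simp add: algebra_simps)
  finally show ?case unfolding eq by (simp del: sqrt_iter.simps sqrt_majorant.simps)
qed (use assms in simp)

lemma Cauchy_sqrt_iter:
  assumes "norm h \<le> 1"
  shows "Cauchy (sqrt_iter h)"
proof -
  have "incseq sqrt_majorant" by (rule incseq_SucI) (rule sqrt_majorant_Suc_ge)
  then have "convergent sqrt_majorant"
    using incseq_convergent[of sqrt_majorant 1] sqrt_majorant_bounds(2) convergentI by blast
  then have "Cauchy sqrt_majorant" by (rule convergent_Cauchy)
  have diff: "norm (sqrt_iter h (m + k) - sqrt_iter h m) \<le> sqrt_majorant (m + k) - sqrt_majorant m" for m k
  proof (induction k)
    case (Suc k)
    then show ?case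
      using norm_sqrt_iter_step[OF assms, of "m + k"]
        norm_triangle_ineq[of "sqrt_iter h (Suc (m + k)) - sqrt_iter h (m + k)"
          "sqrt_iter h (m + k) - sqrt_iter h m"]
      by (simp del: sqrt_iter.simps sqrt_majorant.simps)
  qed simp
  show ?thesis
  proof (rule metric_CauchyI)
    fix e :: real assume "e > 0"
    then obtain M where M: "\<And>m n. m \<ge> M \<Longrightarrow> n \<ge> M \<Longrightarrow> dist (sqrt_majorant m) (sqrt_majorant n) < e"
      using \<open>Cauchy sqrt_majorant\<close> unfolding Cauchy_def by meson
    have *: "dist (sqrt_iter h m) (sqrt_iter h n) < e" if "M \<le> m" "m \<le> n" for m n
      using diff[of m "n - m"] M[of m n] that
      by (simp add: dist_norm norm_minus_commute)
    show "\<exists>M. \<forall>m\<ge>M. \<forall>n\<ge>M. dist (sqrt_iter h m) (sqrt_iter h n) < e"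
      using * by (metis dist_commute nat_le_linear)
  qed
qed

text \<open>The second conclusion is an induction principle for the limit: every later property of
  the root is obtained by exhibiting a closed set that contains \<open>0\<close> and is stable under
  the iteration step.\<close>

lemma sqrt_one_minus:
  fixes h :: "'a::cstar_algebra"
  assumes "norm h \<le> 1"
  obtains y where "(1 - y) * (1 - y) = 1 - h"
    and "\<And>C. closed C \<Longrightarrow> 0 \<in> C \<Longrightarrow> (\<And>z. z \<in> C \<Longrightarrow> (1/2) *\<^sub>R (h + z * z) \<in> C) \<Longrightarrow> y \<in> C"
proof -
  obtain y where y: "sqrt_iter h \<longlonglongrightarrow> y"
    using Cauchy_sqrt_iter[OF assms] Cauchy_convergent convergentD by blast
  have "(\<lambda>n. sqrt_iter h (Suc n)) \<longlonglongrightarrow> (1/2) *\<^sub>R (h + y * y)"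
    unfolding sqrt_iter.simps by (intro tendsto_intros y)
  then have fix_pt: "y = (1/2) *\<^sub>R (h + y * y)"
    using LIMSEQ_Suc[OF y] LIMSEQ_unique by blast
  show ?thesis
  proof
    have "2 *\<^sub>R y = h + y * y" by (subst fix_pt) simp
    then have "y + y = h + y * y" by (simp add: scaleR_2)
    then show "(1 - y) * (1 - y) = 1 - h" by (simp add: algebra_simps)
  next
    fix C assume C: "closed C" "0 \<in> C" "\<And>z. z \<in> C \<Longrightarrow> (1/2) *\<^sub>R (h + z * z) \<in> C"
    have "sqrt_iter h n \<in> C" for n by (induction n) (use C in auto)
    then show "y \<in> C" using closed_sequentially[OF C(1)] y by blast
  qed
qed

subsection \<open>The positive cone\<close>

text \<open>Positivity is first taken to mean being the square of a selfadjoint element; that all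
  elements \<open>cstar b * b\<close> are of this form is the Fukamiya--Kaplansky theorem below.\<close>

definition pos :: "'a::cstar_algebra \<Rightarrow> bool" where
  "pos x \<longleftrightarrow> (\<exists>s. cstar s = s \<and> x = s * s)"

lemma pos_square: "cstar s = s \<Longrightarrow> pos (s * s)"
  by (auto simp: pos_def)

lemma pos_selfadjoint: "pos x \<Longrightarrow> cstar x = x"
  by (auto simp: pos_def cstar_mult)

lemma pos_zero [simp]: "pos (0::'a::cstar_algebra)"
  using pos_square[of "0::'a"] by simp

lemma pos_scaleR:
  assumes "pos x" "0 \<le> r"
  shows "pos (r *\<^sub>R x)"
proof -
  obtain s where s: "cstar s = s" "x = s * s" using assms unfolding pos_def by blast
  have "r *\<^sub>R x = (sqrt r *\<^sub>R s) * (sqrt r *\<^sub>R s)"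
    using assms(2) s(2) by simp
  then show ?thesis using pos_square[of "sqrt r *\<^sub>R s"] s(1) by simp
qed

lemma pos_scaleR_one: "0 \<le> r \<Longrightarrow> pos (r *\<^sub>R (1::'a::cstar_algebra))"
  using pos_scaleR[OF pos_square[of "1::'a"], of r] by simp

lemma norm_le_one_of_sum_squares:
  fixes x y :: "'a::cstar_algebra"
  assumes x: "cstar x = x" and y: "cstar y = y" and comm: "x * y = y * x"
    and sum: "x * x + y * y = 1"
  shows "norm x \<le> 1"
proof -
  \<comment> \<open>\<open>u = x + iy\<close> is unitary and \<open>x\<close> is its real part.\<close>
  define u where "u = x + \<i> *\<^sub>C y"
  have su: "cstar u = x - \<i> *\<^sub>C y"
    by (simp add: u_def cstar_add cstar_cscale x y cscale_minus_left)
  have "(\<i> *\<^sub>C y) * (\<i> *\<^sub>C y) = (\<i> * \<i>) *\<^sub>C (y * y)"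
    by (metis cscale_mult_left cscale_mult_right cscale_cscale)
  then have "(\<i> *\<^sub>C y) * (\<i> *\<^sub>C y) = - (y * y)"
    by (simp add: cscale_minus_left cscale_one)
  moreover have "(\<i> *\<^sub>C y) * x = x * (\<i> *\<^sub>C y)"
    by (metis cscale_mult_left cscale_mult_right comm)
  ultimately have "cstar u * u = 1"
    using sum unfolding su by (simp add: u_def algebra_simps)
  then have "norm u * norm u = 1" using cstar_identity[of u] by simp
  then have nu: "norm u = 1"
    by (metis norm_ge_zero abs_of_nonneg real_sqrt_abs2 real_sqrt_one)
  have "2 *\<^sub>R x = u + cstar u" unfolding su by (simp add: u_def scaleR_2)
  then have "2 * norm x = norm (u + cstar u)"
    by (metis norm_scaleR abs_numeral)
  also have "\<dots> \<le> 2" using norm_triangle_ineq[of u "cstar u"] nu by simp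
  finally show ?thesis by simp
qed

definition unital_endomorphism :: "('a::cstar_algebra \<Rightarrow> 'a) \<Rightarrow> bool" where
  "unital_endomorphism T \<longleftrightarrow> bounded_linear T \<and> T 1 = 1 \<and> (\<forall>x y. T (x * y) = T x * T y)"

lemma sqrt_one_minus_selfadjoint:
  fixes h :: "'a::cstar_algebra"
  assumes h: "cstar h = h" "norm h \<le> 1"
  obtains r where "r * r = 1 - h" "cstar r = r" "norm (1 - r) \<le> 1"
    and "\<And>x. x * h = h * x \<Longrightarrow> x * r = r * x"
    and "\<And>T. unital_endomorphism T \<Longrightarrow> T h = h \<Longrightarrow> T r = r"
proof -
  obtain y where y: "(1 - y) * (1 - y) = 1 - h"
    and C: "\<And>C. closed C \<Longrightarrow> 0 \<in> C \<Longrightarrow> (\<And>z. z \<in> C \<Longrightarrow> (1/2) *\<^sub>R (h + z * z) \<in> C) \<Longrightarrow> y \<in> C"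
    using sqrt_one_minus[OF h(2)] by blast
  show ?thesis
  proof (rule that[of "1 - y"])
    show "(1 - y) * (1 - y) = 1 - h" by (rule y)
    have "y \<in> {x. cstar x = x}"
      by (rule C) (auto simp: closed_selfadjoint cstar_add cstar_mult h)
    then show "cstar (1 - y) = 1 - y" by (simp add: cstar_diff)
    \<comment> \<open>This bound is what later makes the root itself positive, via
      \<open>pos_of_norm_one_minus_le\<close>.\<close>
    have "y \<in> cball 0 1"
    proof (rule C)
      fix z :: 'a assume "z \<in> cball 0 1"
      then have "norm z \<le> 1" by simp
      then have "norm (z * z) \<le> 1"
        using norm_mult_ineq[of z z] mult_le_one[of "norm z" "norm z"] by simp
      then have "norm (h + z * z) \<le> 2" using h(2) norm_triangle_ineq[of h "z * z"] by simp
      then show "(1/2) *\<^sub>R (h + z * z) \<in> cball 0 1" by simp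
    qed auto
    then show "norm (1 - (1 - y)) \<le> 1" by simp
  next
    fix x assume x: "x * h = h * x"
    have "y \<in> {z. x * z = z * x}"
    proof (rule C)
      show "closed {z. x * z = z * x}" by (intro closed_Collect_eq continuous_intros)
      fix z assume "z \<in> {z. x * z = z * x}"
      then have z: "x * z = z * x" by simp
      have "x * (z * z) = z * x * z" by (simp add: z flip: mult.assoc)
      then have "x * (z * z) = z * z * x" by (simp add: z mult.assoc)
      then show "(1/2) *\<^sub>R (h + z * z) \<in> {z. x * z = z * x}"
        using x by (simp add: algebra_simps)
    qed simp
    then show "x * (1 - y) = (1 - y) * x" by (simp add: algebra_simps)
  next
    fix T :: "'a \<Rightarrow> 'a"
    assume "unital_endomorphism T" and Th: "T h = h"
    then have T: "bounded_linear T" "T 1 = 1" "\<And>x y. T (x * y) = T x * T y"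
      by (auto simp: unital_endomorphism_def)
    interpret bounded_linear T by fact
    have "y \<in> {z. T z = z}"
    proof (rule C)
      show "closed {z. T z = z}"
        by (intro closed_Collect_eq continuous_intros linear_continuous_on T(1))
    qed (auto simp: add scaleR T Th zero)
    then show "T (1 - y) = 1 - y" by (simp add: diff T)
  qed
qed

section \<open>Positivity as a norm inequality\<close>

lemma pos_of_norm_one_minus_le:
  assumes "cstar h = h" "norm (1 - h) \<le> 1"
  shows "pos h"
proof -
  have "cstar (1 - h) = 1 - h" using assms by (simp add: cstar_diff)
  then show ?thesis
  proof (rule sqrt_one_minus_selfadjoint[OF _ assms(2)])
    fix r assume "r * r = 1 - (1 - h)" "cstar r = r"
    then show "pos h" using pos_square[of r] by simp
  qed
qed

text \<open>The root \<open>r\<close> of \<open>1 - s * s\<close> commutes with \<open>s\<close> and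
  \<open>r * r + s * s = 1\<close>, so \<open>r\<close> is the real part of a unitary and has norm
  at most \<open>1\<close>; finally \<open>1 - s * s = r * r\<close>.\<close>

lemma norm_one_minus_square_le:
  fixes s :: "'a::cstar_algebra"
  assumes s: "cstar s = s" "norm s \<le> 1"
  shows "norm (1 - s * s) \<le> 1"
proof -
  have ns: "norm (s * s) \<le> 1"
    using norm_mult_ineq[of s s] mult_le_one[of "norm s" "norm s"] s by simp
  have ss: "cstar (s * s) = s * s" using s by (simp add: cstar_mult)
  show ?thesis
  proof (rule sqrt_one_minus_selfadjoint[OF ss ns])
    fix r assume r: "r * r = 1 - s * s" "cstar r = r"
      and comm: "\<And>x. x * (s * s) = s * s * x \<Longrightarrow> x * r = r * x"
    have "norm r \<le> 1"
      using norm_le_one_of_sum_squares[of r s] r s comm[of s] by (simp add: mult.assoc)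
    then show "norm (1 - s * s) \<le> 1"
      using r(1) norm_mult_ineq[of r r] mult_le_one[of "norm r" "norm r"] by simp
  qed
qed

text \<open>Rescaling \<open>s\<close> by \<open>1 / sqrt t\<close> reduces to the case
  \<open>t = 1\<close>. With the converse that follows, positivity becomes a norm inequality, which
  survives sums and limits.\<close>

lemma norm_diff_pos_le:
  assumes "pos x" "norm x \<le> t"
  shows "norm (t *\<^sub>R 1 - x) \<le> t"
proof (cases "t = 0")
  case False
  then have t: "t > 0" using assms(2) norm_ge_zero[of x] by linarith
  obtain s where s: "cstar s = s" "x = s * s" using assms(1) unfolding pos_def by blast
  define s' where "s' = (1 / sqrt t) *\<^sub>R s"
  have ss: "s' * s' = (1 / t) *\<^sub>R x" using t by (simp add: s'_def s(2))
  have "norm s' * norm s' = norm x / t"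
    using norm_square_selfadjoint[of s'] s(1) t ss by (simp add: s'_def)
  also have "\<dots> \<le> 1 * 1" using assms(2) t by simp
  finally have "norm s' \<le> 1" by (rule power2_le_imp_le[of _ 1, unfolded power2_eq_square]) simp
  then have "norm (1 - (1 / t) *\<^sub>R x) \<le> 1"
    using norm_one_minus_square_le[of s'] s(1) ss by (simp add: s'_def)
  then have "t * norm (1 - (1 / t) *\<^sub>R x) \<le> t" using t by simp
  moreover have "t *\<^sub>R 1 - x = t *\<^sub>R (1 - (1 / t) *\<^sub>R x)" using t by (simp add: scaleR_diff_right)
  ultimately show ?thesis using t by simp
qed (use assms in simp)

lemma pos_of_norm_diff_le:
  assumes "cstar h = h" "norm (t *\<^sub>R 1 - h) \<le> t" "t > 0"
  shows "pos h"
proof -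
  have "t *\<^sub>R 1 - h = t *\<^sub>R (1 - (1 / t) *\<^sub>R h)" using assms(3) by (simp add: scaleR_diff_right)
  then have "norm (1 - (1 / t) *\<^sub>R h) \<le> 1" using assms(2,3) by simp
  then have "pos ((1 / t) *\<^sub>R h)" using assms(1) by (intro pos_of_norm_one_minus_le) simp_all
  from pos_scaleR[OF this, of t] show ?thesis using assms(3) by simp
qed

lemma pos_add:
  assumes "pos x" "pos y"
  shows "pos (x + y)"
proof (rule pos_of_norm_diff_le)
  \<comment> \<open>The summand \<open>1\<close> keeps \<open>?s + ?t\<close> strictly positive even
    for \<open>x = y = 0\<close>.\<close>
  let ?s = "norm x + 1" and ?t = "norm y + 1"
  show "cstar (x + y) = x + y" using assms by (simp add: cstar_add pos_selfadjoint)
  show "norm ((?s + ?t) *\<^sub>R 1 - (x + y)) \<le> ?s + ?t"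
    unfolding scaleR_left.add
    using norm_diff_pos_le[OF assms(1), of ?s] norm_diff_pos_le[OF assms(2), of ?t]
      norm_triangle_ineq[of "?s *\<^sub>R 1 - x" "?t *\<^sub>R 1 - y"]
    by (simp add: algebra_simps flip: scaleR_2)
  show "?s + ?t > 0" using norm_ge_zero[of x] norm_ge_zero[of y] by linarith
qed

lemma pos_sum: "(\<And>i. i \<in> I \<Longrightarrow> pos (f i)) \<Longrightarrow> pos (sum f I)"
  by (induction I rule: infinite_finite_induct) (auto intro: pos_add)

text \<open>A norm bound \<open>K\<close> valid for the whole sequence serves as one common
  \<open>t\<close> in the norm criterion, which then passes to the limit.\<close>

lemma pos_closed:
  assumes "\<And>n. pos (X n)" "X \<longlonglongrightarrow> x"
  shows "pos x"
proof -
  obtain K where K: "\<And>n. norm (X n) \<le> K" "K > 0"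
    using convergent_imp_Bseq[OF convergentI[OF assms(2)]] by (metis BseqE)
  have "(\<lambda>n. norm (K *\<^sub>R 1 - X n)) \<longlonglongrightarrow> norm (K *\<^sub>R 1 - x)"
    by (intro tendsto_intros assms)
  then have "norm (K *\<^sub>R 1 - x) \<le> K"
    by (rule LIMSEQ_le_const2) (use norm_diff_pos_le[OF assms(1) K(1)] in auto)
  moreover have "x \<in> {x. cstar x = x}"
    using closed_sequentially[OF closed_selfadjoint, of X x] assms by (simp add: pos_selfadjoint)
  ultimately show ?thesis using pos_of_norm_diff_le[of x K] K(2) by simp
qed

lemma pos_norm_minus:
  assumes "cstar h = h" "norm h \<le> t"
  shows "pos (t *\<^sub>R 1 - h)"
proof (cases "t = 0")
  case False
  then have "t > 0" using assms(2) norm_ge_zero[of h] by linarith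
  then show ?thesis
    using assms by (intro pos_of_norm_diff_le[of _ t]) (simp_all add: cstar_diff)
qed (use assms in simp)

text \<open>The root of \<open>1 - h\<close> with \<open>h = 1 - x / t\<close>, rescaled by
  \<open>sqrt t\<close>. The commutation clause feeds \<open>norm_le_one_of_sum_squares\<close>; the
  last clause keeps roots of fixed points among the fixed points.\<close>

lemma pos_sqrt:
  assumes "pos x"
  obtains r where "r * r = x" "pos r"
    and "\<And>y. y * x = x * y \<Longrightarrow> y * r = r * y"
    and "\<And>T. unital_endomorphism T \<Longrightarrow> T x = x \<Longrightarrow> T r = r"
proof -
  define t where "t = norm x + 1"
  have t: "t > 0" "norm x \<le> t" using norm_ge_zero[of x] by (simp_all add: t_def del: norm_ge_zero)
  define h where "h = 1 - (1 / t) *\<^sub>R x"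
  have "t *\<^sub>R 1 - x = t *\<^sub>R h" using t(1) by (simp add: h_def scaleR_diff_right)
  then have nh: "norm h \<le> 1" using norm_diff_pos_le[OF assms t(2)] t(1) by simp
  have sh: "cstar h = h" using pos_selfadjoint[OF assms] by (simp add: h_def cstar_diff)
  obtain r where r: "r * r = 1 - h" "cstar r = r" "norm (1 - r) \<le> 1"
    and comm: "\<And>x. x * h = h * x \<Longrightarrow> x * r = r * x"
    and fixed: "\<And>T. unital_endomorphism T \<Longrightarrow> T h = h \<Longrightarrow> T r = r"
    by (rule sqrt_one_minus_selfadjoint[OF sh nh]) (rule that)
  show ?thesis
  proof (rule that[of "sqrt t *\<^sub>R r"])
    show "(sqrt t *\<^sub>R r) * (sqrt t *\<^sub>R r) = x" using t r(1) by (simp add: h_def)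
    show "pos (sqrt t *\<^sub>R r)" using t r by (intro pos_scaleR pos_of_norm_one_minus_le) auto
    show "y * (sqrt t *\<^sub>R r) = sqrt t *\<^sub>R r * y" if "y * x = x * y" for y
    proof -
      have "y * h = h * y" using that by (simp add: h_def algebra_simps)
      then show ?thesis using comm[of y] by simp
    qed
    show "T (sqrt t *\<^sub>R r) = sqrt t *\<^sub>R r"
      if T: "unital_endomorphism T" and Tx: "T x = x" for T
    proof -
      interpret bounded_linear T using T by (simp add: unital_endomorphism_def)
      have "T h = h" using T by (simp add: h_def diff scaleR Tx unital_endomorphism_def)
      then show ?thesis using fixed[OF T] by (simp add: scaleR)
    qed
  qed
qed

section \<open>Recovering the norm from the order\<close>

lemma norm_le_one_of_pos_one_minus_square:
  fixes x :: "'a::cstar_algebra"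
  assumes "cstar x = x" "pos (1 - x * x)"
  shows "norm x \<le> 1"
proof -
  show ?thesis
  proof (rule pos_sqrt[OF assms(2)])
    fix r assume r: "r * r = 1 - x * x" "pos r"
      and comm: "\<And>y. y * (1 - x * x) = (1 - x * x) * y \<Longrightarrow> y * r = r * y"
    have "x * r = r * x" by (rule comm) (simp add: algebra_simps)
    then show "norm x \<le> 1"
      using norm_le_one_of_sum_squares[of x r] assms(1) r by (simp add: pos_selfadjoint)
  qed
qed

lemma norm_le_of_pos_diff_aux:
  assumes "pos c" "pos (t *\<^sub>R 1 - c)" "t > 0"
  shows "norm c \<le> t"
proof -
  obtain s where s: "cstar s = s" "c = s * s" using assms(1) unfolding pos_def by blast
  define x where "x = (1 / sqrt t) *\<^sub>R s"
  have xx: "x * x = (1 / t) *\<^sub>R c" using assms(3) by (simp add: x_def s(2))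
  have "1 - x * x = (1 / t) *\<^sub>R (t *\<^sub>R 1 - c)" using assms(3) by (simp add: xx scaleR_diff_right)
  then have "pos (1 - x * x)" using pos_scaleR[OF assms(2), of "1 / t"] assms(3) by simp
  moreover have "cstar x = x" using s(1) by (simp add: x_def)
  ultimately have "norm x \<le> 1" by (intro norm_le_one_of_pos_one_minus_square)
  then have "norm (x * x) \<le> 1"
    using norm_mult_ineq[of x x] mult_le_one[of "norm x" "norm x"] by simp
  then show ?thesis using assms(3) by (simp add: xx field_simps)
qed

lemma norm_le_of_pos_diff:
  fixes c :: "'a::cstar_algebra"
  assumes "pos c" "pos (t *\<^sub>R 1 - c)"
  shows "norm c \<le> t"
proof -
  have t0: "t \<ge> 0"
  proof (rule ccontr)
    \<comment> \<open>A negative \<open>t\<close> makes a negative multiple of \<open>1\<close>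
      positive. Rescaled to \<open>-1/2 = 1/2 - 1\<close>, it gives
      \<open>norm 1 \<le> 1/2\<close>.\<close>
    assume "\<not> t \<ge> 0"
    have pt: "pos (t *\<^sub>R (1::'a))" using pos_add[OF assms] by simp
    have "pos ((1 / (2 * - t)) *\<^sub>R (t *\<^sub>R (1::'a)))" using \<open>\<not> t \<ge> 0\<close> by (intro pos_scaleR[OF pt]) auto
    moreover have "(1 / (2 * - t)) *\<^sub>R (t *\<^sub>R (1::'a)) = (1/2) *\<^sub>R 1 - 1"
      using \<open>\<not> t \<ge> 0\<close> by (simp add: algebra_simps flip: scaleR_2)
    moreover have "pos (1::'a)" using pos_scaleR_one[of 1] by simp
    ultimately show False using norm_le_of_pos_diff_aux[of "1::'a" "1/2"] by simp
  qed
  show ?thesis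
  \<comment> \<open>The auxiliary lemma asks for a strictly positive bound, so \<open>t = 0\<close>
    is reached through \<open>t + e\<close>.\<close>
  proof (rule field_le_epsilon)
    fix e :: real assume e: "e > 0"
    have "pos ((t + e) *\<^sub>R 1 - c)"
      using pos_add[OF assms(2) pos_scaleR_one[of e]] e by (simp add: algebra_simps)
    then show "norm c \<le> t + e" using norm_le_of_pos_diff_aux[OF assms(1)] t0 e by simp
  qed
qed

subsection \<open>The Fukamiya--Kaplansky theorem\<close>

text \<open>Squaring preserves the hypotheses, so \<open>norm a ^ 2 ^ n\<close> stays below \<open>2\<close>.\<close>

lemma norm_power_le_two:
  fixes a b c :: "'a::cstar_algebra"
  assumes "cstar a = a" "cstar b = b" "cstar c = c"
    and "a + b = 1 + c" "a * b = c" "b * a = c" "norm c \<le> 1"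
  shows "norm a ^ 2 ^ Suc n \<le> 2"
  using assms
proof (induction n arbitrary: a b c)
  case 0
  have cc: "norm (c * c) \<le> 1"
    using 0 norm_mult_ineq[of c c] mult_le_one[of "norm c" "norm c"] by simp
  have "(a + b) * (a + b) = (1 + c) * (1 + c)" using 0 by simp
  \<comment> \<open>The cross terms \<open>a * b + b * a\<close> on the left and \<open>2 c\<close>
    on the right cancel.\<close>
  then have sq: "a * a + b * b = 1 + c * c" using 0(5,6) by (simp add: algebra_simps)
  have "pos (1 *\<^sub>R 1 - c * c)" using 0 cc by (intro pos_norm_minus) (simp_all add: cstar_mult)
  then have "pos (1 *\<^sub>R 1 - c * c + b * b)" using 0 by (intro pos_add pos_square)
  moreover have "1 *\<^sub>R 1 - c * c + b * b = 2 *\<^sub>R 1 - a * a"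
    using sq by (simp add: scaleR_2 algebra_simps)
  ultimately have "norm (a * a) \<le> 2" using 0 by (intro norm_le_of_pos_diff pos_square) simp_all
  then show ?case using norm_square_selfadjoint[of a] 0 by (simp add: power2_eq_square)
next
  case (Suc n)
  have "(a + b) * (a + b) = (1 + c) * (1 + c)" using Suc.prems by simp
  then have sq: "a * a + b * b = 1 + c * c" using Suc.prems(5,6) by (simp add: algebra_simps)
  have ab: "a * b = b * a" using Suc.prems(5,6) by simp
  have square_mult: "x * x * (y * y) = x * y * (x * y)" if "x * y = y * x" for x y :: 'a
  proof -
    have "x * x * (y * y) = x * (x * y) * y" by (simp only: mult.assoc)
    also have "\<dots> = x * (y * x) * y" by (simp only: that)
    finally show ?thesis by (simp only: mult.assoc)
  qed
  have "a * a * (b * b) = c * c" "b * b * (a * a) = c * c"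
    using square_mult[OF ab] square_mult[OF ab[symmetric]] Suc.prems(5,6) by simp_all
  moreover have "norm (c * c) \<le> 1"
    using Suc.prems norm_mult_ineq[of c c] mult_le_one[of "norm c" "norm c"] by simp
  ultimately have "norm (a * a) ^ 2 ^ Suc n \<le> 2"
    using Suc.prems sq by (intro Suc.IH[of "a * a" "b * b" "c * c"]) (simp_all add: cstar_mult)
  then show ?case
    using Suc.prems norm_square_selfadjoint[of a] by (simp add: power2_eq_square[symmetric] flip: power_mult)
qed

text \<open>The equations say that \<open>1 - a\<close> and \<open>1 - b\<close> have product zero
  in both orders. The bound \<open>2\<close> on arbitrarily high powers of \<open>norm a\<close>
  excludes \<open>norm a > 1\<close>.\<close>

lemma norm_le_one_of_complementary:
  fixes a b c :: "'a::cstar_algebra"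
  assumes "cstar a = a" "cstar b = b" "cstar c = c"
    and "a + b = 1 + c" "a * b = c" "b * a = c" "norm c \<le> 1"
  shows "norm a \<le> 1"
proof (rule ccontr)
  assume "\<not> norm a \<le> 1"
  then have a: "norm a > 1" by simp
  then obtain n where "2 < norm a ^ n" using real_arch_pow by blast
  also have "\<dots> \<le> norm a ^ 2 ^ Suc n"
    using a less_exp[of "Suc n"] by (intro power_increasing) linarith+
  finally show False using norm_power_le_two[OF assms, of n] by simp
qed

text \<open>With \<open>a\<close> the absolute value of \<open>h\<close>, the root of
  \<open>h * h\<close>, the witness is \<open>n = (a - h) / 2\<close>, so
  \<open>h + 2 n = a\<close>. The difficulty is the positivity of \<open>n\<close>, which follows
  from the orthogonality of \<open>a - h\<close> and \<open>a + h\<close>.\<close>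

lemma negative_part:
  fixes h :: "'a::cstar_algebra"
  assumes h: "cstar h = h"
  obtains n where "pos n" "pos (h + 2 *\<^sub>R n)" "n * h = - (n * n)"
proof -
  obtain a where a: "a * a = h * h" "pos a" and ah: "h * a = a * h"
  proof (rule pos_sqrt[OF pos_square[OF h]])
    fix r assume "r * r = h * h" "pos r" and comm: "\<And>y. y * (h * h) = h * h * y \<Longrightarrow> y * r = r * y"
    moreover have "h * r = r * h" by (rule comm) (simp add: mult.assoc)
    ultimately show thesis by (intro that)
  qed
  have sa: "cstar a = a" using a(2) by (rule pos_selfadjoint)
  define t where "t = norm a + 1"
  have t: "t > 0" "norm a \<le> t" using norm_ge_zero[of a] by (simp_all add: t_def del: norm_ge_zero)
  define u where "u = (1 / (2 * t)) *\<^sub>R (a - h)"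
  define v where "v = (1 / (2 * t)) *\<^sub>R (a + h)"
  have uv: "u * v = 0" "v * u = 0" using a(1) ah by (simp_all add: u_def v_def algebra_simps)
  have su: "cstar u = u" "cstar v = v" using h sa by (simp_all add: u_def v_def cstar_add cstar_diff)
  have "u + v = (1 / (2 * t)) *\<^sub>R (2 *\<^sub>R a)" by (simp add: u_def v_def scaleR_2 algebra_simps)
  then have sum: "u + v = (1 / t) *\<^sub>R a" by simp
  have "norm (1 - u) \<le> 1"
  \<comment> \<open>Since \<open>u * v = 0\<close>, the product of \<open>1 - u\<close> and
    \<open>1 - v\<close> is \<open>1 - (u + v)\<close>. Its norm is at most \<open>1\<close> because
    \<open>u + v = a / t\<close> with \<open>a\<close> positive and
    \<open>norm a \<le> t\<close>.\<close>
  proof (rule norm_le_one_of_complementary[of "1 - u" "1 - v" "1 - (u + v)"])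
    have "t *\<^sub>R 1 - a = t *\<^sub>R (1 - (u + v))" using t by (simp add: sum scaleR_diff_right)
    then show "norm (1 - (u + v)) \<le> 1" using norm_diff_pos_le[OF a(2) t(2)] t(1) by simp
  qed (use uv su in \<open>simp_all add: algebra_simps cstar_diff cstar_add\<close>)
  then have "pos u" using su by (intro pos_of_norm_one_minus_le)
  then have "pos (t *\<^sub>R u)" using t by (intro pos_scaleR) auto
  moreover have tu: "t *\<^sub>R u = (1/2) *\<^sub>R (a - h)" using t by (simp add: u_def)
  moreover have "h + 2 *\<^sub>R ((1/2) *\<^sub>R (a - h)) = a" by simp
  moreover have "(1/2) *\<^sub>R (a - h) * h = - ((1/2) *\<^sub>R (a - h) * ((1/2) *\<^sub>R (a - h)))"
  proof -
    have "(a - h) * (a - h) = 2 *\<^sub>R (h * h - a * h)"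
      using a(1) ah by (simp add: algebra_simps scaleR_2)
    then have "(1/2) *\<^sub>R (a - h) * ((1/2) *\<^sub>R (a - h)) = (1/2) *\<^sub>R (h * h - a * h)"
      by simp
    then show ?thesis by (simp add: algebra_simps)
  qed
  ultimately show ?thesis using that[of "(1/2) *\<^sub>R (a - h)"] a(2) by simp
qed

definition re_part :: "'a::cstar_algebra \<Rightarrow> 'a" where
  "re_part x = (1/2) *\<^sub>R (x + cstar x)"

lemma cstar_re_part [simp]: "cstar (re_part x) = re_part x"
  by (simp add: re_part_def cstar_add cstar_cstar add.commute)

text \<open>The second \<open>re_part\<close> is the imaginary part of \<open>x\<close>.\<close>

lemma re_part_decomp: "x = re_part x + \<i> *\<^sub>C re_part ((- \<i>) *\<^sub>C x)"
proof -
  have "\<i> *\<^sub>C re_part ((- \<i>) *\<^sub>C x) = (1/2) *\<^sub>R (x - cstar x)"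
    by (simp add: re_part_def cscale_scaleR cscale_add_right cstar_cscale cscale_cscale
        cscale_one cscale_minus_left cscale_minus_right cscale_diff_right)
  then have "re_part x + \<i> *\<^sub>C re_part ((- \<i>) *\<^sub>C x) = (1/2) *\<^sub>R (2 *\<^sub>R x)"
    by (simp add: re_part_def algebra_simps scaleR_2)
  then show ?thesis by simp
qed

text \<open>For \<open>c = x + i y\<close> with \<open>x\<close>, \<open>y\<close> selfadjoint the
  sum equals \<open>2 (x * x + y * y)\<close>.\<close>

lemma pos_cstar_mult_add:
  fixes c :: "'a::cstar_algebra"
  shows "pos (cstar c * c + c * cstar c)"
proof -
  define x where "x = re_part c"
  define y where "y = re_part ((- \<i>) *\<^sub>C c)"
  define z where "z = \<i> *\<^sub>C y"
  have sx: "cstar x = x" "cstar y = y" by (simp_all add: x_def y_def)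
  have c: "c = x + z" unfolding x_def y_def z_def by (rule re_part_decomp)
  have sc: "cstar c = x - z" by (simp add: c z_def cstar_add cstar_cscale sx cscale_minus_left)
  have "z * z = (\<i> * \<i>) *\<^sub>C (y * y)"
    unfolding z_def by (metis cscale_mult_left cscale_mult_right cscale_cscale)
  then have zz: "z * z = - (y * y)" by (simp add: cscale_minus_left cscale_one)
  have "cstar c * c + c * cstar c = 2 *\<^sub>R (x * x - z * z)"
    unfolding sc unfolding c by (simp add: algebra_simps scaleR_2)
  also have "\<dots> = 2 *\<^sub>R (x * x + y * y)" by (simp add: zz)
  finally show ?thesis using sx by (simp add: pos_scaleR pos_add pos_square)
qed

text \<open>For a normalised counterexample \<open>d\<close>, also \<open>d * cstar d\<close> is
  positive, of norm \<open>1\<close>. Then \<open>x = 1 + d * cstar d\<close> has norm at least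
  \<open>2\<close>, so \<open>norm (x * x) \<ge> 4\<close>. But
  \<open>x * x = 1 + d * (1 + w) * cstar d\<close> with \<open>w = 1 + cstar d * d\<close>, and
  \<open>norm w \<le> 1\<close> because \<open>- (cstar d * d)\<close> is positive; this gives at
  most \<open>3\<close>.\<close>

lemma pos_neg_cstar_mult_imp_zero:
  fixes c :: "'a::cstar_algebra"
  assumes "pos (- (cstar c * c))"
  shows "c = 0"
proof (rule ccontr)
  assume "c \<noteq> 0"
  define d where "d = (1 / norm c) *\<^sub>R c"
  have nd: "norm d = 1" using \<open>c \<noteq> 0\<close> by (simp add: d_def)
  have "- (cstar d * d) = (1 / norm c * (1 / norm c)) *\<^sub>R (- (cstar c * c))"
    by (simp add: d_def)
  then have neg: "pos (- (cstar d * d))" using pos_scaleR[OF assms, of "1 / norm c * (1 / norm c)"] by simp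
  have dd: "pos (d * cstar d)" using pos_add[OF pos_cstar_mult_add[of d] neg] by simp
  have ndd: "norm (d * cstar d) = 1" using cstar_identity[of "cstar d"] nd by (simp add: cstar_cstar)
  define x where "x = 1 + d * cstar d"
  have sx: "cstar x = x" by (simp add: x_def cstar_add cstar_mult cstar_cstar)
  have "pos (norm x *\<^sub>R 1 - x)" using sx by (intro pos_norm_minus) auto
  then have "pos ((norm x - 1) *\<^sub>R 1 - d * cstar d)" by (simp add: x_def algebra_simps)
  then have "norm x \<ge> 2" using norm_le_of_pos_diff[OF dd] ndd by fastforce
  then have "2 * 2 \<le> norm x * norm x" by (intro mult_mono) auto
  then have ge: "norm (x * x) \<ge> 4" using norm_square_selfadjoint[OF sx] by simp
  define w where "w = 1 + cstar d * d"
  have "norm w \<le> 1"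
    using norm_diff_pos_le[OF neg, of 1] cstar_identity[of d] nd by (simp add: w_def)
  then have "norm (1 + w) \<le> 2" using norm_triangle_ineq[of 1 w] by simp
  then have "norm (d * (1 + w) * cstar d) \<le> 2"
    using norm_mult_ineq[of "d * (1 + w)" "cstar d"] norm_mult_ineq[of d "1 + w"] nd by simp
  moreover have "x * x = 1 + d * (1 + w) * cstar d"
    by (simp add: x_def w_def algebra_simps)
  ultimately have "norm (x * x) \<le> 3"
    using norm_triangle_ineq[of 1 "d * (1 + w) * cstar d"] by simp
  with ge show False by simp
qed

text \<open>The negative part \<open>n\<close> of \<open>h = cstar b * b\<close> satisfies
  \<open>cstar (b * n) * (b * n) = n * h * n = - (n * n * n)\<close>. As \<open>n * n * n\<close> is
  positive, the preceding lemma gives \<open>b * n = 0\<close>, hence \<open>n = 0\<close> and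
  \<open>h = h + 2 n\<close> is positive.\<close>

theorem pos_cstar_mult: "pos (cstar b * (b::'a::cstar_algebra))"
proof -
  define h where "h = cstar b * b"
  have sh: "cstar h = h" by (simp add: h_def cstar_mult cstar_cstar)
  obtain n where n: "pos n" "pos (h + 2 *\<^sub>R n)" "n * h = - (n * n)"
    using negative_part[OF sh] by blast
  have sn: "cstar n = n" using n(1) by (rule pos_selfadjoint)
  obtain q where q: "cstar q = q" "n = q * q" using n(1) unfolding pos_def by blast
  have "cstar (b * n) * (b * n) = n * h * n" by (simp add: cstar_mult sn h_def mult.assoc)
  then have cc: "cstar (b * n) * (b * n) = - (n * n * n)" using n(3) by simp
  have "n * n * n = (q * q * q) * (q * q * q)" by (simp add: q(2) mult.assoc)
  moreover have "cstar (q * q * q) = q * q * q" using q(1) by (simp add: cstar_mult mult.assoc)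
  ultimately have "pos (n * n * n)" by (metis pos_square)
  then have "b * n = 0" using pos_neg_cstar_mult_imp_zero[of "b * n"] cc by simp
  then have "n * n * n = 0" using cc by simp
  then have "(n * n) * (n * n) = 0" by (simp add: mult.assoc)
  then have "norm (n * n) = 0"
    using norm_square_selfadjoint[of "n * n"] sn by (simp add: cstar_mult)
  then have "n = 0" using norm_square_selfadjoint[OF sn] by simp
  then show ?thesis using n(2) by (simp add: h_def)
qed

subsection \<open>A Hahn--Banach theorem\<close>

text \<open>A pair \<open>(x, r)\<close> of the cone \<open>R\<close> stands for the constraint \<open>\<phi> x \<le> r\<close>. Sublinear functionals
  are thus replaced by their epigraphs, and Zorn's lemma applies to unions of cones.\<close>

definition constraint_cone :: "('a::real_vector \<times> real) set \<Rightarrow> bool" where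
  "constraint_cone R \<longleftrightarrow> (0, 0) \<in> R \<and>
     (\<forall>x r y s. (x, r) \<in> R \<longrightarrow> (y, s) \<in> R \<longrightarrow> (x + y, r + s) \<in> R) \<and>
     (\<forall>x r t. (x, r) \<in> R \<longrightarrow> 0 < t \<longrightarrow> (t *\<^sub>R x, t * r) \<in> R) \<and>
     (\<forall>r. (0, r) \<in> R \<longrightarrow> 0 \<le> r)"

lemma constraint_coneI:
  assumes "(0, 0) \<in> R"
    and "\<And>x r y s. (x, r) \<in> R \<Longrightarrow> (y, s) \<in> R \<Longrightarrow> (x + y, r + s) \<in> R"
    and "\<And>x r t. (x, r) \<in> R \<Longrightarrow> 0 < t \<Longrightarrow> (t *\<^sub>R x, t * r) \<in> R"
    and "\<And>r. (0, r) \<in> R \<Longrightarrow> 0 \<le> r"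
  shows "constraint_cone R"
  using assms unfolding constraint_cone_def by blast

lemma constraint_coneD:
  assumes "constraint_cone R"
  shows "(0, 0) \<in> R"
    and "(x, r) \<in> R \<Longrightarrow> (y, s) \<in> R \<Longrightarrow> (x + y, r + s) \<in> R"
    and "(x, r) \<in> R \<Longrightarrow> 0 < t \<Longrightarrow> (t *\<^sub>R x, t * r) \<in> R"
    and "(0, r) \<in> R \<Longrightarrow> 0 \<le> r"
  using assms unfolding constraint_cone_def by blast+

text \<open>Adjoins the constraint \<open>s \<le> \<phi> z\<close>, encoded as
  \<open>\<phi> (- z) \<le> - s\<close>. It is consistent because \<open>s\<close> does not exceed
  any upper bound already imposed on \<open>z\<close>.\<close>

lemma constraint_cone_extend:
  assumes R: "constraint_cone R" and s: "\<And>r. (z, r) \<in> R \<Longrightarrow> s \<le> r"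
  shows "constraint_cone {(x - t *\<^sub>R z, r - t * s) | x r t. (x, r) \<in> R \<and> 0 \<le> t}"
    (is "constraint_cone ?S")
proof (rule constraint_coneI)
  show "(0, 0) \<in> ?S" using constraint_coneD(1)[OF R] by force
next
  fix x r y s'
  assume "(x, r) \<in> ?S" "(y, s') \<in> ?S"
  then obtain x1 r1 t1 x2 r2 t2 where 1: "(x1, r1) \<in> R" "0 \<le> t1" "x = x1 - t1 *\<^sub>R z" "r = r1 - t1 * s"
    and 2: "(x2, r2) \<in> R" "0 \<le> t2" "y = x2 - t2 *\<^sub>R z" "s' = r2 - t2 * s" by auto
  have "x + y = (x1 + x2) - (t1 + t2) *\<^sub>R z" "r + s' = (r1 + r2) - (t1 + t2) * s"
    unfolding 1(3,4) 2(3,4) by (simp_all add: algebra_simps)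
  moreover have "(x1 + x2, r1 + r2) \<in> R" "0 \<le> t1 + t2"
    using constraint_coneD(2)[OF R 1(1) 2(1)] 1 2 by simp_all
  ultimately show "(x + y, r + s') \<in> ?S" by blast
next
  fix x r and t :: real
  assume "(x, r) \<in> ?S" "0 < t"
  then obtain x1 r1 t1 where 1: "(x1, r1) \<in> R" "0 \<le> t1" "x = x1 - t1 *\<^sub>R z" "r = r1 - t1 * s" by auto
  have "t *\<^sub>R x = t *\<^sub>R x1 - (t * t1) *\<^sub>R z" "t * r = t * r1 - (t * t1) * s"
    unfolding 1(3,4) by (simp_all add: algebra_simps)
  moreover have "(t *\<^sub>R x1, t * r1) \<in> R" "0 \<le> t * t1"
    using constraint_coneD(3)[OF R 1(1) \<open>0 < t\<close>] 1 \<open>0 < t\<close> by simp_all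
  ultimately show "(t *\<^sub>R x, t * r) \<in> ?S" by blast
next
  fix r' assume "(0, r') \<in> ?S"
  then obtain x r t where 1: "(x, r) \<in> R" "0 \<le> t" "0 = x - t *\<^sub>R z" "r' = r - t * s" by auto
  show "0 \<le> r'"
  proof (cases "t = 0")
    case True
    then show ?thesis using 1 constraint_coneD(4)[OF R] by auto
  next
    case False
    then have t: "t > 0" using 1 by simp
    have "((1 / t) *\<^sub>R x, (1 / t) * r) \<in> R" using constraint_coneD(3)[OF R 1(1), of "1 / t"] t by simp
    moreover have "(1 / t) *\<^sub>R x = z" using 1(3) t by simp
    ultimately have "s \<le> (1 / t) * r" using s by simp
    then show ?thesis using 1(4) t by (simp add: field_simps)
  qed
qed

lemma constraint_cone_Union:
  assumes "C \<noteq> {}" and cone: "\<And>R. R \<in> C \<Longrightarrow> constraint_cone R"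
    and chain: "\<And>R S. R \<in> C \<Longrightarrow> S \<in> C \<Longrightarrow> R \<subseteq> S \<or> S \<subseteq> R"
  shows "constraint_cone (\<Union>C)"
proof (rule constraint_coneI)
  show "(0, 0) \<in> \<Union>C" using assms(1) constraint_coneD(1)[OF cone] by blast
  show "(x + y, r + s) \<in> \<Union>C" if xy: "(x, r) \<in> \<Union>C" "(y, s) \<in> \<Union>C" for x r y s
  proof -
    obtain R where "R \<in> C" "(x, r) \<in> R" "(y, s) \<in> R" using xy chain by blast
    then show ?thesis using constraint_coneD(2)[OF cone] by blast
  qed
  show "(t *\<^sub>R x, t * r) \<in> \<Union>C" if "(x, r) \<in> \<Union>C" "0 < t" for x r t
    using that constraint_coneD(3)[OF cone] by blast
  show "0 \<le> r" if "(0, r) \<in> \<Union>C" for r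
    using that constraint_coneD(4)[OF cone] by blast
qed

text \<open>In a maximal cone \<open>M\<close> the best upper bound \<open>\<phi> x\<close> is also
  enforced as a lower bound. The graph of \<open>\<phi>\<close> then lies in \<open>M\<close>, and
  the cone operations make \<open>\<phi>\<close> sublinear and odd, hence linear.\<close>

theorem hahn_banach_cone:
  fixes R :: "('a::real_vector \<times> real) set"
  assumes R: "constraint_cone R" and total: "\<And>x. \<exists>r. (x, r) \<in> R"
  obtains \<phi> where "linear \<phi>" and "\<And>x r. (x, r) \<in> R \<Longrightarrow> \<phi> x \<le> r"
proof -
  let ?A = "{S. constraint_cone S \<and> R \<subseteq> S}"
  have "\<exists>M\<in>?A. \<forall>X\<in>?A. M \<subseteq> X \<longrightarrow> X = M"
  proof (rule subset_Zorn_nonempty)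
    show "?A \<noteq> {}" using R by blast
    fix C assume C: "C \<noteq> {}" "subset.chain ?A C"
    then have "constraint_cone (\<Union>C)"
      unfolding subset_chain_def by (intro constraint_cone_Union) blast+
    moreover have "R \<subseteq> \<Union>C" using C unfolding subset_chain_def by blast
    ultimately show "\<Union>C \<in> ?A" by simp
  qed
  then obtain M where M: "constraint_cone M" "R \<subseteq> M"
    and max: "\<And>X. constraint_cone X \<Longrightarrow> M \<subseteq> X \<Longrightarrow> X = M"
    by (auto dest: order_trans)
  note D = constraint_coneD[OF M(1)]
  define \<phi> where "\<phi> x = Inf {r. (x, r) \<in> M}" for x
  have ne: "{r. (x, r) \<in> M} \<noteq> {}" for x using total M(2) by blast
  have opp: "- s \<le> r" if "(x, r) \<in> M" "(- x, s) \<in> M" for x r s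
    using D(2)[OF that] D(4)[of "r + s"] by simp
  have bdd: "bdd_below {r. (x, r) \<in> M}" for x
  proof -
    obtain s where "(- x, s) \<in> M" using ne[of "- x"] by blast
    then show ?thesis using opp by (intro bdd_belowI[of _ "- s"]) blast
  qed
  have le: "\<phi> x \<le> r" if "(x, r) \<in> M" for x r
    unfolding \<phi>_def using that by (intro cInf_lower bdd) simp
  have ge: "c \<le> \<phi> x" if "\<And>r. (x, r) \<in> M \<Longrightarrow> c \<le> r" for x c
    unfolding \<phi>_def using that ne by (intro cInf_greatest) auto
  \<comment> \<open>By maximality, adjoining the consistent constraint that \<open>\<phi> x\<close>
    is a lower bound at \<open>x\<close> adds nothing to \<open>M\<close>.\<close>
  have neg: "(- x, - \<phi> x) \<in> M" for x
  proof -
    let ?S = "{(y - t *\<^sub>R x, r - t * \<phi> x) | y r t. (y, r) \<in> M \<and> 0 \<le> t}"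
    have "?S = M"
    proof (rule max)
      show "constraint_cone ?S" using le by (intro constraint_cone_extend[OF M(1)])
      show "M \<subseteq> ?S" by force
    qed
    moreover have "(0 - 1 *\<^sub>R x, 0 - 1 * \<phi> x) \<in> ?S" using D(1) zero_le_one by blast
    ultimately show ?thesis by simp
  qed
  have minus: "\<phi> (- x) = - \<phi> x" for x
  proof (rule antisym)
    show "\<phi> (- x) \<le> - \<phi> x" by (rule le) (rule neg)
    show "- \<phi> x \<le> \<phi> (- x)"
    proof (rule ge)
      fix r assume "(- x, r) \<in> M"
      then have "- r \<le> \<phi> x" using opp[of x] by (intro ge) force
      then show "- \<phi> x \<le> r" by simp
    qed
  qed
  have graph: "(x, \<phi> x) \<in> M" for x using neg[of "- x"] minus[of x] by simp
  have add_le: "\<phi> (x + y) \<le> \<phi> x + \<phi> y" for x y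
    by (rule le) (rule D(2)[OF graph graph])
  have scale_le: "\<phi> (t *\<^sub>R x) \<le> t * \<phi> x" if "0 < t" for t x
    using le[OF D(3)[OF graph that]] .
  have add: "\<phi> (x + y) = \<phi> x + \<phi> y" for x y
    using add_le[of x y] add_le[of "- x" "- y"] minus[of "x + y"] minus[of x] minus[of y] by simp
  have scale_pos: "\<phi> (t *\<^sub>R x) = t * \<phi> x" if "0 < t" for t x
    using scale_le[OF that, of x] scale_le[OF that, of "- x"] minus[of x] minus[of "t *\<^sub>R x"] by simp
  have scale: "\<phi> (t *\<^sub>R x) = t * \<phi> x" for t x
  proof (cases t "0::real" rule: linorder_cases)
    case less
    then show ?thesis using scale_pos[of "- t" x] minus[of "t *\<^sub>R x"] by simp
  next
    case equal
    then show ?thesis using add[of 0 0] by simp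
  next
    case greater
    then show ?thesis by (rule scale_pos)
  qed
  show ?thesis
  proof (rule that)
    show "linear \<phi>" by (rule linearI) (simp_all add: add scale)
    show "\<phi> x \<le> r" if "(x, r) \<in> R" for x r using le that M(2) by blast
  qed
qed

lemma separating_functional:
  fixes V :: "'a::real_normed_vector set"
  assumes V: "subspace V" and z: "z \<notin> closure V"
  obtains \<phi> K where "linear \<phi>" "\<And>v. v \<in> V \<Longrightarrow> \<phi> v = 0" "\<phi> z \<noteq> 0" "\<And>x. \<phi> x \<le> K * norm x"
proof -
  obtain \<delta> where \<delta>: "\<delta> > 0" and dist: "\<And>v. v \<in> V \<Longrightarrow> \<delta> \<le> norm (z - v)"
    using z unfolding closure_approachable by (metis dist_norm dist_commute not_less)
  \<comment> \<open>\<open>?U\<close> is generated by three constraints: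
    \<open>\<phi> y \<le> norm y / \<delta>\<close> everywhere, \<open>\<phi> v \<le> 0\<close> on
    \<open>V\<close>, and \<open>\<phi> z \<ge> 1\<close>. They are compatible since
    \<open>z\<close> has distance at least \<open>\<delta>\<close> from \<open>V\<close>.\<close>
  let ?U = "{(x, r). \<exists>y v t. v \<in> V \<and> 0 \<le> t \<and> x = y + v - t *\<^sub>R z \<and> norm y / \<delta> - t \<le> r}"
  have "constraint_cone ?U"
  proof (rule constraint_coneI)
    show "(0, 0) \<in> ?U" using subspace_0[OF V] by (auto intro!: exI[of _ 0])
  next
    fix x r y s assume "(x, r) \<in> ?U" "(y, s) \<in> ?U"
    then obtain x1 v1 t1 x2 v2 t2 where 1: "v1 \<in> V" "0 \<le> t1" "x = x1 + v1 - t1 *\<^sub>R z" "norm x1 / \<delta> - t1 \<le> r"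
      and 2: "v2 \<in> V" "0 \<le> t2" "y = x2 + v2 - t2 *\<^sub>R z" "norm x2 / \<delta> - t2 \<le> s" by auto
    have "norm (x1 + x2) / \<delta> \<le> (norm x1 + norm x2) / \<delta>"
      using \<delta> by (intro divide_right_mono norm_triangle_ineq) auto
    then have "norm (x1 + x2) / \<delta> - (t1 + t2) \<le> r + s" using 1 2 by (simp add: add_divide_distrib)
    moreover have "x + y = (x1 + x2) + (v1 + v2) - (t1 + t2) *\<^sub>R z"
      unfolding 1(3) 2(3) by (simp add: algebra_simps)
    ultimately show "(x + y, r + s) \<in> ?U"
      using subspace_add[OF V 1(1) 2(1)] 1(2) 2(2) add_nonneg_nonneg by blast
  next
    fix x r and c :: real assume "(x, r) \<in> ?U" "0 < c"
    then obtain x1 v1 t1 where 1: "v1 \<in> V" "0 \<le> t1" "x = x1 + v1 - t1 *\<^sub>R z" "norm x1 / \<delta> - t1 \<le> r" by auto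
    have "c * (norm x1 / \<delta> - t1) \<le> c * r" using 1 \<open>0 < c\<close> by simp
    then have "norm (c *\<^sub>R x1) / \<delta> - c * t1 \<le> c * r" using \<open>0 < c\<close> by (simp add: algebra_simps)
    moreover have "c *\<^sub>R x = c *\<^sub>R x1 + c *\<^sub>R v1 - (c * t1) *\<^sub>R z" unfolding 1(3) by (simp add: algebra_simps)
    moreover have "0 \<le> c * t1" using \<open>0 < c\<close> 1 by simp
    ultimately show "(c *\<^sub>R x, c * r) \<in> ?U"
      using subspace_scale[OF V 1(1), of c] by blast
  next
    fix r assume "(0, r) \<in> ?U"
    then obtain x v t where 1: "v \<in> V" "0 \<le> t" "0 = x + v - t *\<^sub>R z" "norm x / \<delta> - t \<le> r" by auto
    have "t \<le> norm x / \<delta>"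
    proof (cases "t = 0")
      case False
      then have t: "t > 0" using 1 by simp
      have "x = t *\<^sub>R (z - (1 / t) *\<^sub>R v)" using 1(3) t by (simp add: algebra_simps)
      then have "norm x = t * norm (z - (1 / t) *\<^sub>R v)" using t by simp
      also have "\<dots> \<ge> t * \<delta>" using dist[OF subspace_scale[OF V 1(1)]] t by simp
      finally show ?thesis using \<delta> by (simp add: field_simps)
    qed (use \<delta> in simp)
    then show "0 \<le> r" using 1(4) by simp
  qed
  moreover have "\<exists>r. (x, r) \<in> ?U" for x
  proof -
    have "(x, norm x / \<delta>) \<in> ?U"
      using subspace_0[OF V] by (simp, intro exI[of _ x] bexI[of _ 0] exI[of _ 0] conjI) auto
    then show ?thesis by blast
  qed
  ultimately obtain \<phi> where \<phi>: "linear \<phi>" and le: "\<And>x r. (x, r) \<in> ?U \<Longrightarrow> \<phi> x \<le> r"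
    by (rule hahn_banach_cone) blast
  have bound: "\<phi> (y + v - t *\<^sub>R z) \<le> norm y / \<delta> - t" if "v \<in> V" "0 \<le> t" for y v t
    using that by (intro le) blast
  have V0: "\<phi> v \<le> 0" if "v \<in> V" for v using bound[of v 0 0] that by simp
  show ?thesis
  proof (rule that[of \<phi> "1 / \<delta>"])
    show "\<phi> v = 0" if "v \<in> V" for v
      using V0[OF that] V0[OF subspace_neg[OF V that]] linear_neg[OF \<phi>] by simp
    show "\<phi> z \<noteq> 0" using bound[of 0 1 0] subspace_0[OF V] linear_neg[OF \<phi>] by auto
    show "\<phi> x \<le> 1 / \<delta> * norm x" for x using bound[of 0 0 x] subspace_0[OF V] by simp
  qed (rule \<phi>)
qed

subsection \<open>Complex functionals from real ones\<close>

text \<open>The complex linear functional whose real part is the real linear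
  \<open>\<phi>\<close>.\<close>

definition complexify :: "('a::cstar_algebra \<Rightarrow> real) \<Rightarrow> 'a \<Rightarrow> complex" where
  "complexify \<phi> x = Complex (\<phi> x) (- \<phi> (\<i> *\<^sub>C x))"

lemma complexify_cscale:
  assumes "linear \<phi>"
  shows "complexify \<phi> (c *\<^sub>C x) = c * complexify \<phi> x"
proof -
  interpret linear \<phi> by fact
  have "\<phi> (c *\<^sub>C y) = Re c * \<phi> y + Im c * \<phi> (\<i> *\<^sub>C y)" for c y
    using cscale_Complex[of c y] by (simp add: add scale)
  from this[of c x] this[of "\<i> * c" x] show ?thesis
    by (simp add: complexify_def complex_eq_iff cscale_cscale)
qed

lemma clinear_on_complexify:
  assumes "linear \<phi>"
  shows "clinear_on S (complexify \<phi>)"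
proof -
  have "complexify \<phi> (x + y) = complexify \<phi> x + complexify \<phi> y" for x y
    by (simp add: complexify_def cscale_add_right complex_eq_iff linear_add[OF assms])
  then show ?thesis by (simp add: clinear_on_def complexify_cscale[OF assms])
qed

text \<open>Rotating \<open>x\<close> by a unimodular \<open>c\<close> makes the value real and
  equal to its modulus without changing \<open>norm x\<close>.\<close>

lemma cmod_complexify_le:
  assumes "linear \<phi>" and le: "\<And>x. \<phi> x \<le> K * norm x"
  shows "cmod (complexify \<phi> x) \<le> K * norm x"
proof (cases "complexify \<phi> x = 0")
  case True
  then have "\<phi> x = 0" by (simp add: complexify_def complex_eq_iff)
  then show ?thesis using le[of x] True by simp
next
  case False
  define c where "c = cnj (complexify \<phi> x) / complex_of_real (cmod (complexify \<phi> x))"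
  have "cmod c = 1" using False by (simp add: c_def norm_divide)
  have "complexify \<phi> (c *\<^sub>C x) = complex_of_real (cmod (complexify \<phi> x))"
    using False complex_norm_square[of "complexify \<phi> x"]
    by (simp add: complexify_cscale[OF assms(1)] c_def field_simps power2_eq_square)
  then have "\<phi> (c *\<^sub>C x) = cmod (complexify \<phi> x)"
    by (simp add: complexify_def[of \<phi> "c *\<^sub>C x"] complex_eq_iff)
  then show ?thesis using le[of "c *\<^sub>C x"] \<open>cmod c = 1\<close> by (simp add: norm_cscale)
qed

lemma bounded_functional_complexify:
  assumes "linear \<phi>" and "\<And>x. \<phi> x \<le> K * norm x"
  shows "bounded_functional_on S (complexify \<phi>)"
  using clinear_on_complexify[OF assms(1)] cmod_complexify_le[OF assms]
  by (auto simp: bounded_functional_on_def bounded_on_def)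

lemma bounded_linear_of_bounded_functional:
  assumes "bounded_functional_on UNIV g"
  shows "bounded_linear g"
proof -
  from assms obtain K where K: "\<And>x. cmod (g x) \<le> K * norm x"
    and add: "\<And>x y. g (x + y) = g x + g y" and scale: "\<And>c x. g (c *\<^sub>C x) = c * g x"
    by (auto simp: bounded_functional_on_def bounded_on_def clinear_on_def)
  show ?thesis
  proof (rule bounded_linear_intro)
    show "g (r *\<^sub>R x) = r *\<^sub>R g x" for r x
      using scale[of "complex_of_real r" x] by (simp add: cscale_of_real scaleR_conv_of_real)
    show "norm (g x) \<le> norm x * K" for x using K[of x] by (simp add: mult.commute)
  qed (rule add)
qed

lemma linear_re_part: "linear (re_part :: 'a::cstar_algebra \<Rightarrow> 'a)"
  by (rule linearI) (simp_all add: re_part_def cstar_add algebra_simps)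

lemma re_part_selfadjoint: "cstar x = x \<Longrightarrow> re_part x = x"
  by (simp add: re_part_def flip: scaleR_2)

lemma re_part_cstar: "re_part (cstar x) = re_part x"
  by (simp add: re_part_def cstar_cstar add.commute)

lemma norm_re_part_le: "norm (re_part x) \<le> norm x"
  using norm_triangle_ineq[of x "cstar x"] by (simp add: re_part_def)

lemma positive_functional_le:
  assumes "linear \<phi>" and pos: "\<And>c. pos c \<Longrightarrow> 0 \<le> \<phi> c" and h: "cstar h = h"
  shows "\<phi> h \<le> \<phi> 1 * norm h"
  using pos[OF pos_norm_minus[OF h order_refl]]
  by (simp add: linear_diff[OF assms(1)] linear_scale[OF assms(1)] mult.commute)

text \<open>Hermitian symmetry makes the values on selfadjoint elements real, and
  \<open>pos_cstar_mult\<close> covers the elements tested by \<open>state_on\<close>. The set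
  \<open>S\<close> is kept general in order to obtain states of the fixed-point algebra and of the
  whole algebra alike.\<close>

lemma state_on_complexify:
  fixes \<phi> :: "'a::cstar_algebra \<Rightarrow> real"
  assumes lin: "linear \<phi>" and star: "\<And>x. \<phi> (cstar x) = \<phi> x"
    and pos: "\<And>c. pos c \<Longrightarrow> 0 \<le> \<phi> c" and one: "\<phi> 1 = 1" and S: "1 \<in> S"
  shows "state_on S (complexify \<phi>)"
proof -
  interpret linear \<phi> by (rule lin)
  have "\<phi> x = \<phi> (re_part x)" for x
    by (simp add: re_part_def scale add star)
  then have le: "\<phi> x \<le> 1 * norm x" for x
    using positive_functional_le[OF lin pos, of "re_part x"] one norm_re_part_le[of x] by simp
  have skew: "\<phi> (\<i> *\<^sub>C x) = 0" if "cstar x = x" for x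
    using star[of "\<i> *\<^sub>C x"] that by (simp add: cstar_cscale cscale_minus_left neg)
  have "Sup {cmod (complexify \<phi> x) | x. x \<in> S \<and> norm x \<le> 1} = 1"
  proof (rule cSup_eq_maximum)
    have "cmod (complexify \<phi> 1) = 1" using skew[of 1] one by (simp add: complexify_def cmod_def)
    then show "1 \<in> {cmod (complexify \<phi> x) | x. x \<in> S \<and> norm x \<le> 1}"
      using S by (intro CollectI exI[of _ 1]) simp
    show "y \<le> 1" if "y \<in> {cmod (complexify \<phi> x) | x. x \<in> S \<and> norm x \<le> 1}" for y
      using that by (auto intro: order_trans[OF cmod_complexify_le[OF lin le]])
  qed
  moreover have "Im (complexify \<phi> a) = 0 \<and> 0 \<le> Re (complexify \<phi> a)" if "positive_in S a" for a
  proof -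
    have "pos a" using that pos_cstar_mult by (auto simp: positive_in_def)
    then show ?thesis using pos[of a] skew[OF pos_selfadjoint] by (simp add: complexify_def)
  qed
  ultimately show ?thesis
    using bounded_functional_complexify[OF lin le] by (simp add: state_on_def functional_norm_on_def)
qed

subsection \<open>Automorphisms and their ergodic averages\<close>

locale cstar_automorphism =
  fixes \<alpha> :: "'a::cstar_algebra \<Rightarrow> 'a"
  assumes aut: "star_automorphism \<alpha>"
begin

abbreviation "Fix \<equiv> fixed_points \<alpha>"
abbreviation "Cob \<equiv> range (\<lambda>a. a - \<alpha> a)"
abbreviation "avg \<equiv> ergodic_avg \<alpha>"

lemma aut_add: "\<alpha> (x + y) = \<alpha> x + \<alpha> y"
  and aut_cscale: "\<alpha> (c *\<^sub>C x) = c *\<^sub>C \<alpha> x"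
  and aut_mult: "\<alpha> (x * y) = \<alpha> x * \<alpha> y"
  and aut_cstar: "\<alpha> (cstar x) = cstar (\<alpha> x)"
  using aut by (simp_all add: star_automorphism_def)

lemma linear_aut: "linear \<alpha>"
proof (rule linearI)
  show "\<alpha> (r *\<^sub>R x) = r *\<^sub>R \<alpha> x" for r x
    using aut_cscale[of "complex_of_real r" x] by (simp add: cscale_of_real)
qed (rule aut_add)

lemma aut_one: "\<alpha> 1 = 1"
proof -
  obtain e where "\<alpha> e = 1" using aut by (metis star_automorphism_def bij_pointE)
  then show ?thesis using aut_mult[of 1 e] by simp
qed

lemma pos_aut: "pos x \<Longrightarrow> pos (\<alpha> x)"
  by (auto simp: pos_def aut_mult) (metis aut_cstar)

text \<open>\<alpha> maps \<open>norm (cstar x * x) 1 - cstar x * x\<close> to a positive element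
  and fixes \<open>1\<close>; the order then bounds the norm of
  \<open>\<alpha> (cstar x * x)\<close>, and the C*-identity returns to \<open>x\<close>.\<close>

lemma norm_aut_le: "norm (\<alpha> x) \<le> norm x"
proof -
  have "pos (\<alpha> (norm (cstar x * x) *\<^sub>R 1 - cstar x * x))"
    by (intro pos_aut pos_norm_minus) (simp_all add: cstar_mult cstar_cstar)
  then have "pos (norm (cstar x * x) *\<^sub>R 1 - \<alpha> (cstar x * x))"
    by (simp add: linear_diff[OF linear_aut] linear_scale[OF linear_aut] aut_one)
  then have "norm (\<alpha> (cstar x * x)) \<le> norm (cstar x * x)"
    by (intro norm_le_of_pos_diff pos_aut pos_cstar_mult)
  then have "norm (\<alpha> x) * norm (\<alpha> x) \<le> norm x * norm x"
    by (simp add: aut_mult aut_cstar cstar_identity)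
  then show ?thesis by (rule power2_le_imp_le[unfolded power2_eq_square]) simp
qed

lemma bounded_linear_aut: "bounded_linear \<alpha>"
  by (rule bounded_linear_intro[of _ 1]) (simp_all add: aut_add linear_scale[OF linear_aut] norm_aut_le)

lemma unital_endomorphism_aut: "unital_endomorphism \<alpha>"
  by (simp add: unital_endomorphism_def bounded_linear_aut aut_one aut_mult)

lemma linear_aut_power: "linear (\<alpha> ^^ k)"
proof (induction k)
  case (Suc k)
  then show ?case using linear_compose[OF Suc linear_aut] by (simp add: comp_def)
qed (simp add: linear_ident)

lemma cscale_aut_power: "(\<alpha> ^^ k) (c *\<^sub>C x) = c *\<^sub>C (\<alpha> ^^ k) x"
  by (induction k) (simp_all add: aut_cscale)

lemma cstar_aut_power: "(\<alpha> ^^ k) (cstar x) = cstar ((\<alpha> ^^ k) x)"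
  by (induction k) (simp_all add: aut_cstar)

lemma pos_aut_power: "pos x \<Longrightarrow> pos ((\<alpha> ^^ k) x)"
  by (induction k) (simp_all add: pos_aut)

lemma norm_aut_power_le: "norm ((\<alpha> ^^ k) x) \<le> norm x"
  by (induction k) (auto intro: order_trans[OF norm_aut_le])

lemma fixed_aut_power: "x \<in> Fix \<Longrightarrow> (\<alpha> ^^ k) x = x"
  by (induction k) (simp_all add: fixed_points_def)

lemma subspace_Fix: "subspace Fix"
  by (simp add: subspace_def fixed_points_def linear_0[OF linear_aut] aut_add linear_scale[OF linear_aut])

lemma one_in_Fix: "1 \<in> Fix"
  by (simp add: fixed_points_def aut_one)

lemma cscale_in_Fix: "x \<in> Fix \<Longrightarrow> c *\<^sub>C x \<in> Fix"
  by (simp add: fixed_points_def aut_cscale)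

lemma aut_re_part: "\<alpha> (re_part x) = re_part (\<alpha> x)"
  by (simp add: re_part_def linear_scale[OF linear_aut] aut_add aut_cstar)

lemma re_part_in_Fix: "x \<in> Fix \<Longrightarrow> re_part x \<in> Fix"
  by (simp add: fixed_points_def aut_re_part)

lemma subspace_Cob: "subspace Cob"
proof -
  have "linear (\<lambda>a. a - \<alpha> a)" using linear_aut by (intro linear_compose_sub linear_ident)
  then show ?thesis by (intro linear_subspace_image subspace_UNIV)
qed

text \<open>\<open>positive_in\<close> demands a root inside the fixed points; the root from
  \<open>pos_sqrt\<close> is fixed by every unital endomorphism that fixes \<open>x\<close>, in
  particular by \<alpha>.\<close>

lemma pos_in_Fix_imp_positive_in:
  assumes "pos x" "x \<in> Fix"
  shows "positive_in Fix x"
proof (rule pos_sqrt[OF assms(1)])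
  fix r assume r: "r * r = x" "pos r" and "\<And>T. unital_endomorphism T \<Longrightarrow> T x = x \<Longrightarrow> T r = r"
  then have "r \<in> Fix" using unital_endomorphism_aut assms(2) by (simp add: fixed_points_def)
  then show "positive_in Fix x"
    using r pos_selfadjoint[OF r(2)] unfolding positive_in_def by (intro bexI[of _ r]) simp_all
qed

section \<open>Ergodic averages and coboundaries\<close>

lemma linear_avg: "linear (\<lambda>a. avg a n)"
  unfolding ergodic_avg_def
  by (intro linear_compose_scale_right linear_compose_sum ballI linear_aut_power)

lemma avg_add: "avg (a + b) = (\<lambda>n. avg a n + avg b n)"
  by (simp add: fun_eq_iff linear_add[OF linear_avg])

lemma avg_cscale: "avg (c *\<^sub>C a) = (\<lambda>n. c *\<^sub>C avg a n)"
proof -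
  have "(\<Sum>k<n. c *\<^sub>C f k) = c *\<^sub>C (\<Sum>k<n. f k)" for f :: "nat \<Rightarrow> 'a" and n
    by (induction n) (simp_all add: cscale_add_right)
  then show ?thesis by (simp add: ergodic_avg_def fun_eq_iff cscale_aut_power cscale_scaleR)
qed

lemma aut_avg: "\<alpha> (avg a n) = avg (\<alpha> a) n"
  by (simp add: ergodic_avg_def linear_scale[OF linear_aut] linear_sum[OF linear_aut] funpow_swap1)

lemma avg_cstar: "avg (cstar a) n = cstar (avg a n)"
proof -
  have "(\<Sum>k<n. cstar (f k)) = cstar (\<Sum>k<n. f k)" for f :: "nat \<Rightarrow> 'a"
    by (induction n) (simp_all add: cstar_add)
  then show ?thesis by (simp add: ergodic_avg_def cstar_aut_power)
qed

lemma pos_avg: "pos a \<Longrightarrow> pos (avg a n)"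
  unfolding ergodic_avg_def by (intro pos_scaleR pos_sum pos_aut_power) simp_all

lemma norm_avg_le: "norm (avg a n) \<le> norm a"
proof (cases "n = 0")
  case False
  have "norm (\<Sum>k<n. (\<alpha> ^^ k) a) \<le> (\<Sum>k<n. norm a)"
    by (intro sum_norm_le norm_aut_power_le)
  then show ?thesis using False by (simp add: ergodic_avg_def field_simps)
qed (simp add: ergodic_avg_def)

text \<open>The average with index \<open>0\<close> is an empty sum and equals \<open>0\<close>,
  hence the restriction to \<open>n > 0\<close>.\<close>

lemma avg_fixed: "x \<in> Fix \<Longrightarrow> n > 0 \<Longrightarrow> avg x n = x"
  by (simp add: ergodic_avg_def fixed_aut_power sum_constant_scaleR del: sum_constant)

lemma invariant_functional_avg:
  fixes G :: "'a \<Rightarrow> real"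
  assumes "linear G" "\<And>x. G (\<alpha> x) = G x" "n > 0"
  shows "G (avg a n) = G a"
proof -
  have "G ((\<alpha> ^^ k) a) = G a" for k by (induction k) (simp_all add: assms(2))
  then show ?thesis
    using assms(3) by (simp add: ergodic_avg_def linear_scale[OF assms(1)] linear_sum[OF assms(1)])
qed

lemma avg_coboundary: "avg (a - \<alpha> a) n = (1 / real n) *\<^sub>R (a - (\<alpha> ^^ n) a)"
proof -
  have "(\<Sum>k<n. (\<alpha> ^^ k) (a - \<alpha> a)) = a - (\<alpha> ^^ n) a"
  proof (induction n)
    case (Suc n)
    then show ?case by (simp add: linear_diff[OF linear_aut_power] flip: funpow_swap1)
  qed simp
  then show ?thesis by (simp add: ergodic_avg_def)
qed

lemma avg_coboundary_tendsto: "(\<lambda>n. avg (a - \<alpha> a) n) \<longlonglongrightarrow> 0"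
proof (rule Lim_null_comparison)
  show "\<forall>\<^sub>F n in sequentially. norm (avg (a - \<alpha> a) n) \<le> (2 * norm a) * (1 / real n)"
  proof (intro always_eventually allI)
    fix n
    have "norm (a - (\<alpha> ^^ n) a) \<le> 2 * norm a"
      using norm_triangle_ineq4[of a "(\<alpha> ^^ n) a"] norm_aut_power_le[of n a] by linarith
    then show "norm (avg (a - \<alpha> a) n) \<le> (2 * norm a) * (1 / real n)"
      by (simp add: avg_coboundary divide_right_mono)
  qed
  show "(\<lambda>n. (2 * norm a) * (1 / real n)) \<longlonglongrightarrow> 0"
    by (intro tendsto_mult_right_zero lim_1_over_n)
qed

text \<open>Each \<open>a - (\<alpha> ^^ k) a\<close> telescopes into coboundaries. In the limit
  this yields the second summand in (v).\<close>

lemma diff_avg_in_Cob: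
  assumes "n > 0"
  shows "a - avg a n \<in> Cob"
proof -
  have step: "a - (\<alpha> ^^ k) a \<in> Cob" for k
  proof (induction k)
    case 0
    then show ?case using subspace_0[OF subspace_Cob] by simp
  next
    case (Suc k)
    have "(\<alpha> ^^ k) a - \<alpha> ((\<alpha> ^^ k) a) \<in> Cob" by blast
    from subspace_add[OF subspace_Cob Suc this] show ?case by simp
  qed
  have "a - avg a n = (1 / real n) *\<^sub>R (\<Sum>k<n. a - (\<alpha> ^^ k) a)"
    using assms by (simp add: ergodic_avg_def sum_subtractf scaleR_diff_right sum_constant_scaleR del: sum_constant)
  then show ?thesis
    using subspace_scale[OF subspace_Cob subspace_sum[OF subspace_Cob step]] by simp
qed

lemma vanishes_on_closure_Cob:
  assumes "bounded_linear g" "\<And>a. g (\<alpha> a) = g a" "y \<in> closure Cob"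
  shows "g y = 0"
proof -
  interpret bounded_linear g by fact
  have "closed {y. g y = 0}"
    by (intro closed_Collect_eq continuous_intros linear_continuous_on assms(1))
  then have "closure Cob \<subseteq> {y. g y = 0}"
    by (intro closure_minimal) (auto simp: diff assms(2))
  then show ?thesis using assms(3) by blast
qed

text \<open>The codomain is general, so that the lemma serves functionals as well as conditional
  expectations.\<close>

lemma invariant_maps_eq:
  assumes dec: "{x + y | x y. x \<in> Fix \<and> y \<in> closure Cob} = UNIV"
    and g: "bounded_linear g" "\<And>a. g (\<alpha> a) = g a"
    and g': "bounded_linear g'" "\<And>a. g' (\<alpha> a) = g' a"
    and eq: "\<And>x. x \<in> Fix \<Longrightarrow> g x = g' x"
  shows "g = g'"
proof
  fix a
  have "a \<in> {x + y | x y. x \<in> Fix \<and> y \<in> closure Cob}" unfolding dec by (rule UNIV_I)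
  then obtain x y where "a = x + y" "x \<in> Fix" "y \<in> closure Cob" by blast
  then show "g a = g' a"
    using vanishes_on_closure_Cob[OF g] vanishes_on_closure_Cob[OF g'] eq
    by (simp add: linear_add[OF bounded_linear.linear] g g')
qed

subsection \<open>The mean ergodic projection\<close>

text \<open>The averages converge on the sum of fixed points and coboundaries; since they are
  contractions uniformly in \<open>n\<close>, the Cauchy property passes to the closure by an
  \<open>e / 3\<close> argument.\<close>

lemma convergent_avg_of_dense:
  assumes dense: "closure {x + y | x y. x \<in> Fix \<and> y \<in> Cob} = UNIV"
  shows "convergent (avg a)"
proof -
  have "Cauchy (avg a)"
  proof (rule metric_CauchyI)
    fix e :: real assume "e > 0"
    have "a \<in> closure {x + y | x y. x \<in> Fix \<and> y \<in> Cob}" using dense by simp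
    moreover have "e / 3 > 0" using \<open>e > 0\<close> by simp
    ultimately have "\<exists>z\<in>{x + y | x y. x \<in> Fix \<and> y \<in> Cob}. dist z a < e / 3"
      unfolding closure_approachable by blast
    then obtain x b where x: "x \<in> Fix" and d: "norm (a - (x + (b - \<alpha> b))) < e / 3"
      by (auto simp: dist_norm norm_minus_commute)
    define w where "w = x + (b - \<alpha> b)"
    have "(\<lambda>n. avg x n + avg (b - \<alpha> b) n) \<longlonglongrightarrow> x + 0"
    proof (intro tendsto_add avg_coboundary_tendsto)
      show "avg x \<longlonglongrightarrow> x"
        by (rule tendsto_eventually) (auto intro: eventually_sequentiallyI[of 1] simp: avg_fixed[OF x])
    qed
    then have "avg w \<longlonglongrightarrow> x" by (simp add: w_def avg_add)
    then have "Cauchy (avg w)" by (rule LIMSEQ_imp_Cauchy)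
    then obtain N where N: "\<And>m n. m \<ge> N \<Longrightarrow> n \<ge> N \<Longrightarrow> dist (avg w m) (avg w n) < e / 3"
      using \<open>e > 0\<close> unfolding Cauchy_def by (metis divide_pos_pos zero_less_numeral)
    have close: "dist (avg a n) (avg w n) < e / 3" for n
      using norm_avg_le[of "a - w" n] d by (simp add: dist_norm linear_diff[OF linear_avg] w_def)
    have "dist (avg a m) (avg a n) < e" if "m \<ge> N" "n \<ge> N" for m n
      using N[OF that] close[of m] close[of n] dist_triangle[of "avg a m" "avg a n" "avg w m"]
        dist_triangle[of "avg w m" "avg a n" "avg w n"] by (simp add: dist_commute)
    then show "\<exists>M. \<forall>m\<ge>M. \<forall>n\<ge>M. dist (avg a m) (avg a n) < e" by blast
  qed
  then show ?thesis by (rule Cauchy_convergent)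
qed

definition mean :: "'a \<Rightarrow> 'a" where
  "mean a = lim (avg a)"

context
  assumes conv: "\<And>a. convergent (avg a)"
begin

lemma avg_tendsto_mean: "avg a \<longlonglongrightarrow> mean a"
  using conv by (simp add: mean_def convergent_LIMSEQ_iff)

lemma mean_add: "mean (a + b) = mean a + mean b"
  using tendsto_add[OF avg_tendsto_mean[of a] avg_tendsto_mean[of b]]
  by (intro LIMSEQ_unique[OF avg_tendsto_mean]) (simp add: avg_add)

lemma mean_cscale: "mean (c *\<^sub>C a) = c *\<^sub>C mean a"
  using bounded_linear.tendsto[OF bounded_linear_cscale avg_tendsto_mean[of a], of c]
  by (intro LIMSEQ_unique[OF avg_tendsto_mean]) (simp add: avg_cscale)

lemma norm_mean_le: "norm (mean a) \<le> norm a"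
  by (rule LIMSEQ_le_const2[OF tendsto_norm[OF avg_tendsto_mean]]) (simp add: norm_avg_le)

lemma bounded_linear_mean: "bounded_linear mean"
proof (rule bounded_linear_intro[of _ 1])
  show "mean (r *\<^sub>R x) = r *\<^sub>R mean x" for r x
    using mean_cscale[of "complex_of_real r" x] by (simp add: cscale_of_real)
qed (simp_all add: mean_add norm_mean_le)

lemma mean_fixed: "x \<in> Fix \<Longrightarrow> mean x = x"
proof -
  assume x: "x \<in> Fix"
  have "avg x \<longlonglongrightarrow> x"
    by (rule tendsto_eventually) (auto intro: eventually_sequentiallyI[of 1] simp: avg_fixed[OF x])
  then show ?thesis using avg_tendsto_mean LIMSEQ_unique by blast
qed

lemma mean_aut: "mean (\<alpha> a) = mean a"
  using avg_coboundary_tendsto[of a] LIMSEQ_unique[OF avg_tendsto_mean, of "a - \<alpha> a" 0]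
    mean_add[of "a - \<alpha> a" "\<alpha> a"] by simp

lemma mean_in_Fix: "mean a \<in> Fix"
proof -
  have "(\<lambda>n. \<alpha> (avg a n)) \<longlonglongrightarrow> \<alpha> (mean a)"
    by (intro bounded_linear.tendsto[OF bounded_linear_aut] avg_tendsto_mean)
  then have "\<alpha> (mean a) = mean (\<alpha> a)"
    using avg_tendsto_mean[of "\<alpha> a"] by (simp add: aut_avg LIMSEQ_unique)
  then show ?thesis by (simp add: fixed_points_def mean_aut)
qed

lemma diff_mean_in_closure_Cob: "a - mean a \<in> closure Cob"
proof -
  \<comment> \<open>The shift avoids index \<open>0\<close>, where the difference is
    \<open>a\<close> itself and need not be a coboundary.\<close>
  have "(\<lambda>n. a - avg a (Suc n)) \<longlonglongrightarrow> a - mean a"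
    by (intro tendsto_diff tendsto_const LIMSEQ_Suc avg_tendsto_mean)
  moreover have "a - avg a (Suc n) \<in> Cob" for n by (intro diff_avg_in_Cob) simp
  ultimately show ?thesis
    unfolding closure_sequential by (intro exI[of _ "\<lambda>n. a - avg a (Suc n)"]) simp
qed

lemma decomposition: "{x + y | x y. x \<in> Fix \<and> y \<in> closure Cob} = UNIV"
proof -
  have "a \<in> {x + y | x y. x \<in> Fix \<and> y \<in> closure Cob}" for a
    using mean_in_Fix[of a] diff_mean_in_closure_Cob[of a]
    by (intro CollectI exI[of _ "mean a"] exI[of _ "a - mean a"]) simp
  then show ?thesis by blast
qed

lemma pos_mean: "pos a \<Longrightarrow> pos (mean a)"
  by (rule pos_closed[OF pos_avg avg_tendsto_mean])

lemma conditional_expectation_mean: "conditional_expectation Fix mean"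
proof -
  have "range mean = Fix"
  proof
    show "Fix \<subseteq> range mean" by (metis mean_fixed rangeI subsetI)
  qed (use mean_in_Fix in blast)
  moreover have "Sup {norm (mean x) | x. norm x \<le> 1} = 1"
  proof (rule cSup_eq_maximum)
    show "1 \<in> {norm (mean x) | x. norm x \<le> 1}"
      using mean_fixed[OF one_in_Fix] by (intro CollectI exI[of _ 1]) simp
  qed (use norm_mean_le order_trans in blast)
  moreover have "\<exists>K. \<forall>x. norm (mean x) \<le> K * norm x"
    using norm_mean_le by (intro exI[of _ 1]) simp
  ultimately show ?thesis
    by (simp add: conditional_expectation_def mean_add mean_cscale mean_fixed)
qed

lemma invariant_conditional_expectation_eq_mean:
  assumes "conditional_expectation Fix E" "E \<circ> \<alpha> = E"
  shows "E = mean"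
proof (rule invariant_maps_eq[OF decomposition])
  from assms(1) obtain K where K: "\<And>x. norm (E x) \<le> K * norm x"
    and add: "\<And>x y. E (x + y) = E x + E y" and scale: "\<And>c x. E (c *\<^sub>C x) = c *\<^sub>C E x"
    and fixed: "\<And>x. x \<in> Fix \<Longrightarrow> E x = x"
    by (auto simp: conditional_expectation_def)
  show "bounded_linear E"
  proof (rule bounded_linear_intro)
    show "E (r *\<^sub>R x) = r *\<^sub>R E x" for r x
      using scale[of "complex_of_real r" x] by (simp add: cscale_of_real)
    show "norm (E x) \<le> norm x * K" for x using K[of x] by (simp add: mult.commute)
  qed (rule add)
  show "E x = mean x" if "x \<in> Fix" for x using that by (simp add: fixed mean_fixed)
  show "E (\<alpha> a) = E a" for a using assms(2) by (metis comp_apply)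
qed (rule bounded_linear_mean, rule mean_aut)

lemma bounded_functional_comp_mean:
  assumes "bounded_functional_on Fix f"
  shows "bounded_functional_on UNIV (f \<circ> mean)"
proof -
  from assms obtain K where K: "\<And>x. x \<in> Fix \<Longrightarrow> cmod (f x) \<le> K * norm x"
    by (auto simp: bounded_functional_on_def bounded_on_def)
  have "cmod (f (mean x)) \<le> \<bar>K\<bar> * norm x" for x
  proof -
    have "cmod (f (mean x)) \<le> K * norm (mean x)" by (rule K[OF mean_in_Fix])
    also have "\<dots> \<le> \<bar>K\<bar> * norm x" by (intro mult_mono norm_mean_le) simp_all
    finally show ?thesis .
  qed
  then show ?thesis
    using assms mean_in_Fix
    by (auto simp: bounded_functional_on_def bounded_on_def clinear_on_def mean_add mean_cscale)
qed

text \<open>The norm is preserved because \<open>mean\<close> maps the unit ball onto the unit ball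
  of the fixed points. Positivity is preserved because \<open>mean a\<close> has its root among the
  fixed points.\<close>

lemma state_comp_mean:
  assumes "state_on Fix f"
  shows "state_on UNIV (f \<circ> mean)"
proof -
  have "{cmod ((f \<circ> mean) x) | x. x \<in> UNIV \<and> norm x \<le> 1} = {cmod (f x) | x. x \<in> Fix \<and> norm x \<le> 1}"
    (is "?L = ?R")
  proof
    show "?L \<subseteq> ?R" using mean_in_Fix order_trans[OF norm_mean_le] by fastforce
    show "?R \<subseteq> ?L"
    proof
      fix y assume "y \<in> ?R"
      then obtain x where "y = cmod (f x)" "x \<in> Fix" "norm x \<le> 1" by blast
      then show "y \<in> ?L" using mean_fixed[of x] by (intro CollectI exI[of _ x]) simp
    qed
  qed
  then have "functional_norm_on UNIV (f \<circ> mean) = 1"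
    using assms by (simp add: state_on_def functional_norm_on_def)
  moreover have "Im (f (mean a)) = 0 \<and> 0 \<le> Re (f (mean a))" if "positive_in UNIV a" for a
  proof -
    have "pos a" using that pos_cstar_mult by (auto simp: positive_in_def)
    then have "positive_in Fix (mean a)" by (intro pos_in_Fix_imp_positive_in pos_mean mean_in_Fix)
    then show ?thesis using assms mean_in_Fix by (simp add: state_on_def)
  qed
  ultimately show ?thesis
    using assms bounded_functional_comp_mean by (simp add: state_on_def)
qed

lemma unique_bounded_extension:
  assumes "bounded_functional_on Fix f"
  shows "\<exists>!g. bounded_functional_on UNIV g \<and> g \<circ> \<alpha> = g \<and> (\<forall>x\<in>Fix. g x = f x)"
proof (rule ex_ex1I)
  show "\<exists>g. bounded_functional_on UNIV g \<and> g \<circ> \<alpha> = g \<and> (\<forall>x\<in>Fix. g x = f x)"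
    using bounded_functional_comp_mean[OF assms] by (intro exI[of _ "f \<circ> mean"]) (auto simp: mean_aut mean_fixed)
  show "g = g'" if "bounded_functional_on UNIV g \<and> g \<circ> \<alpha> = g \<and> (\<forall>x\<in>Fix. g x = f x)"
    "bounded_functional_on UNIV g' \<and> g' \<circ> \<alpha> = g' \<and> (\<forall>x\<in>Fix. g' x = f x)" for g g'
    using that bounded_linear_of_bounded_functional
    by (intro invariant_maps_eq[OF decomposition]) (auto dest: fun_cong)
qed

lemma unique_state_extension:
  assumes "state_on Fix f"
  shows "\<exists>!g. state_on UNIV g \<and> g \<circ> \<alpha> = g \<and> (\<forall>x\<in>Fix. g x = f x)"
proof (rule ex_ex1I)
  show "\<exists>g. state_on UNIV g \<and> g \<circ> \<alpha> = g \<and> (\<forall>x\<in>Fix. g x = f x)"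
    using state_comp_mean[OF assms] by (intro exI[of _ "f \<circ> mean"]) (auto simp: mean_aut mean_fixed)
  have "bounded_functional_on Fix f" using assms by (simp add: state_on_def)
  then show "g = g'" if "state_on UNIV g \<and> g \<circ> \<alpha> = g \<and> (\<forall>x\<in>Fix. g x = f x)"
    "state_on UNIV g' \<and> g' \<circ> \<alpha> = g' \<and> (\<forall>x\<in>Fix. g' x = f x)" for g g'
    using unique_bounded_extension that unfolding state_on_def by blast
qed

end

subsection \<open>Density from uniqueness of extensions\<close>

text \<open>Vanishing on coboundaries is invariance. The complexification still vanishes on the
  fixed points because these are stable under multiplication by the imaginary unit.\<close>

lemma annihilating_functional:
  assumes "closure {x + y | x y. x \<in> Fix \<and> y \<in> Cob} \<noteq> UNIV"
  obtains g z where "bounded_functional_on UNIV g" "g \<circ> \<alpha> = g" "\<And>x. x \<in> Fix \<Longrightarrow> g x = 0" "g z \<noteq> 0"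
proof -
  let ?V = "{x + y | x y. x \<in> Fix \<and> y \<in> Cob}"
  obtain z where z: "z \<notin> closure ?V" using assms by blast
  obtain \<phi> K where \<phi>: "linear \<phi>" and V: "\<And>v. v \<in> ?V \<Longrightarrow> \<phi> v = 0" and nz: "\<phi> z \<noteq> 0"
    and le: "\<And>x. \<phi> x \<le> K * norm x"
    using separating_functional[OF subspace_sums[OF subspace_Fix subspace_Cob] z] by blast
  have fixed: "\<phi> x = 0" if "x \<in> Fix" for x
  proof -
    have "x + 0 \<in> ?V" using that subspace_0[OF subspace_Cob] by blast
    then show ?thesis using V by force
  qed
  have inv: "\<phi> (\<alpha> x) = \<phi> x" for x
  proof -
    have "0 + (x - \<alpha> x) \<in> ?V" using subspace_0[OF subspace_Fix] by blast
    then have "\<phi> (x - \<alpha> x) = 0" using V by force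
    then show ?thesis by (simp add: linear_diff[OF \<phi>])
  qed
  show ?thesis
  proof (rule that[of "complexify \<phi>" z])
    show "bounded_functional_on UNIV (complexify \<phi>)" using \<phi> le by (rule bounded_functional_complexify)
    show "complexify \<phi> \<circ> \<alpha> = complexify \<phi>"
      by (simp add: fun_eq_iff complexify_def inv flip: aut_cscale)
    show "complexify \<phi> x = 0" if "x \<in> Fix" for x
      using fixed[OF that] fixed[OF cscale_in_Fix[OF that]] by (simp add: complexify_def complex_eq_iff)
    show "complexify \<phi> z \<noteq> 0" using nz by (simp add: complexify_def complex_eq_iff)
  qed
qed

lemma dense_of_unique_bounded_extension:
  assumes "\<And>f. bounded_functional_on Fix f \<Longrightarrow>
    \<exists>!g. bounded_functional_on UNIV g \<and> g \<circ> \<alpha> = g \<and> (\<forall>x\<in>Fix. g x = f x)"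
  shows "closure {x + y | x y. x \<in> Fix \<and> y \<in> Cob} = UNIV"
proof (rule ccontr)
  have zero: "bounded_functional_on S (\<lambda>_. 0)" for S :: "'a set"
    by (auto simp: bounded_functional_on_def bounded_on_def clinear_on_def intro: exI[of _ 0])
  assume "closure {x + y | x y. x \<in> Fix \<and> y \<in> Cob} \<noteq> UNIV"
  then obtain g z where g: "bounded_functional_on UNIV g" "g \<circ> \<alpha> = g" "\<And>x. x \<in> Fix \<Longrightarrow> g x = 0" "g z \<noteq> 0"
    by (rule annihilating_functional) blast
  have "g = (\<lambda>_. 0)"
  proof (rule ex1E[OF assms[OF zero[of Fix]]])
    fix g'
    assume uniq: "\<forall>k. bounded_functional_on UNIV k \<and> k \<circ> \<alpha> = k \<and> (\<forall>x\<in>Fix. k x = 0) \<longrightarrow> k = g'"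
    have "g = g'" using uniq g by blast
    moreover have "(\<lambda>_. 0) = g'" using uniq zero[of UNIV] by (auto simp: comp_def)
    ultimately show ?thesis by simp
  qed
  then show False using g(4) by simp
qed

text \<open>A Jordan decomposition: \<open>\<phi>\<close> and \<open>\<phi> - G\<close> are positive and invariant. The constraints force
  \<open>\<phi> 1 \<le> M\<close>, \<open>\<phi> c \<ge> 0\<close> and \<open>\<phi> c \<ge> G c\<close> for positive \<open>c\<close>, and that \<open>\<phi>\<close> vanishes on coboundaries and on
  skew elements; averaging along \<open>\<alpha>\<close> shows that they are consistent.\<close>

lemma invariant_positive_majorant:
  fixes G :: "'a \<Rightarrow> real"
  assumes lin: "linear G" and bound: "\<And>x. G x \<le> M * norm x" and M: "0 \<le> M"
    and inv: "\<And>x. G (\<alpha> x) = G x"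
  obtains \<phi> where "linear \<phi>" "\<And>x. \<phi> (cstar x) = \<phi> x" "\<And>x. \<phi> (\<alpha> x) = \<phi> x"
    "\<And>c. pos c \<Longrightarrow> 0 \<le> \<phi> c" "\<And>c. pos c \<Longrightarrow> G c \<le> \<phi> c"
proof -
  \<comment> \<open>\<open>?P a t c x\<close> places \<open>re_part a\<close> below
    \<open>t 1 - c - (x - \<alpha> x)\<close>. A positive, hermitian, invariant \<phi> with
    \<open>\<phi> 1 = M\<close> and \<open>G \<le> \<phi>\<close> on positive elements must then
    satisfy \<open>\<phi> a \<le> M * t - G c\<close>.\<close>
  let ?P = "\<lambda>a t c x. pos c \<and> pos (t *\<^sub>R 1 - re_part a - c - (x - \<alpha> x))"
  let ?R = "{(a, r). \<exists>t c x. ?P a t c x \<and> r = M * t - G c}"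
  have RI: "(a, M * t - G c) \<in> ?R" if "?P a t c x" for a t c x
    using that by blast
  have re0: "re_part 0 = (0::'a)" by (simp add: re_part_def)
  have "constraint_cone ?R"
  proof (rule constraint_coneI)
    show "(0, 0) \<in> ?R"
      using RI[of 0 0 0 0] by (simp add: re0 linear_0[OF lin] linear_0[OF linear_aut])
  next
    fix a r b s assume "(a, r) \<in> ?R" "(b, s) \<in> ?R"
    then obtain t c x t' c' x' where 1: "?P a t c x" "r = M * t - G c" and 2: "?P b t' c' x'" "s = M * t' - G c'"
      by auto
    have "(t + t') *\<^sub>R 1 - re_part (a + b) - (c + c') - ((x + x') - \<alpha> (x + x'))
        = (t *\<^sub>R 1 - re_part a - c - (x - \<alpha> x)) + (t' *\<^sub>R 1 - re_part b - c' - (x' - \<alpha> x'))"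
      by (simp add: aut_add linear_add[OF linear_re_part] algebra_simps)
    then have P: "?P (a + b) (t + t') (c + c') (x + x')" using 1(1) 2(1) by (metis pos_add)
    have "r + s = M * (t + t') - G (c + c')"
      unfolding 1(2) 2(2) by (simp add: linear_add[OF lin] algebra_simps)
    then show "(a + b, r + s) \<in> ?R" using RI[OF P] by simp
  next
    fix a r and k :: real assume "(a, r) \<in> ?R" and k: "0 < k"
    then obtain t c x where 1: "?P a t c x" "r = M * t - G c" by auto
    have "(k * t) *\<^sub>R 1 - re_part (k *\<^sub>R a) - k *\<^sub>R c - (k *\<^sub>R x - \<alpha> (k *\<^sub>R x))
        = k *\<^sub>R (t *\<^sub>R 1 - re_part a - c - (x - \<alpha> x))"
      by (simp add: linear_scale[OF linear_aut] linear_scale[OF linear_re_part] algebra_simps)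
    then have P: "?P (k *\<^sub>R a) (k * t) (k *\<^sub>R c) (k *\<^sub>R x)" using 1(1) k by (metis pos_scaleR less_imp_le)
    have "k * r = M * (k * t) - G (k *\<^sub>R c)"
      unfolding 1(2) by (simp add: linear_scale[OF lin] algebra_simps)
    then show "(k *\<^sub>R a, k * r) \<in> ?R" using RI[OF P] by simp
  next
    fix r assume "(0, r) \<in> ?R"
    then obtain t c x where c: "pos c" and p: "pos (t *\<^sub>R 1 - c - (x - \<alpha> x))" and r: "r = M * t - G c"
      by (auto simp: re0)
    define d where "d = x - \<alpha> x"
    have "d = t *\<^sub>R 1 - c - (t *\<^sub>R 1 - c - (x - \<alpha> x))" by (simp add: d_def)
    then have sd: "cstar d = d"
      using pos_selfadjoint[OF c] pos_selfadjoint[OF p] by (metis cstar_diff cstar_scaleR cstar_one)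
    \<comment> \<open>Averaging leaves \<open>G c\<close> unchanged and makes the coboundary
      \<open>d\<close> small in norm. The averaged inequality bounds \<open>norm (avg c ?m)\<close>
      by \<open>t\<close> plus that small error, and \<open>G\<close> is bounded by \<open>M\<close>
      times the norm.\<close>
    have le: "G c \<le> M * (t + norm (avg d (Suc n)))" for n
    proof -
      let ?m = "Suc n"
      have "pos (avg (t *\<^sub>R 1 - c - d) ?m)" using p by (intro pos_avg) (simp add: d_def)
      then have "pos (t *\<^sub>R 1 - avg c ?m - avg d ?m)"
        using avg_fixed[OF one_in_Fix, of ?m]
        by (simp add: linear_diff[OF linear_avg] linear_scale[OF linear_avg])
      moreover have "pos (norm (avg d ?m) *\<^sub>R 1 - (- avg d ?m))"
        using avg_cstar[of d ?m] sd by (intro pos_norm_minus) simp_all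
      ultimately have "pos ((t *\<^sub>R 1 - avg c ?m - avg d ?m) + (norm (avg d ?m) *\<^sub>R 1 - (- avg d ?m)))"
        by (rule pos_add)
      then have "pos ((t + norm (avg d ?m)) *\<^sub>R 1 - avg c ?m)" by (simp add: algebra_simps)
      then have "norm (avg c ?m) \<le> t + norm (avg d ?m)" by (intro norm_le_of_pos_diff pos_avg c)
      then have "M * norm (avg c ?m) \<le> M * (t + norm (avg d ?m))" using M by (rule mult_left_mono)
      moreover have "G (avg c ?m) = G c" by (rule invariant_functional_avg[OF lin inv]) simp
      ultimately show ?thesis using bound[of "avg c ?m"] by simp
    qed
    have "(\<lambda>n. M * (t + norm (avg d (Suc n)))) \<longlonglongrightarrow> M * (t + norm (0::'a))"
      unfolding d_def by (intro tendsto_intros LIMSEQ_Suc avg_coboundary_tendsto)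
    then have "G c \<le> M * (t + norm (0::'a))" by (rule LIMSEQ_le_const) (use le in blast)
    then show "0 \<le> r" using r by simp
  qed
  moreover have "\<exists>r. (a, r) \<in> ?R" for a
  proof -
    have "?P a (norm (re_part a)) 0 0"
      using pos_norm_minus[of "re_part a"] by (simp add: linear_0[OF linear_aut])
    then show ?thesis using RI by blast
  qed
  ultimately obtain \<phi> where \<phi>: "linear \<phi>" and le: "\<And>a r. (a, r) \<in> ?R \<Longrightarrow> \<phi> a \<le> r"
    by (rule hahn_banach_cone) blast
  have bd: "\<phi> a \<le> M * t - G c" if "?P a t c x" for a t c x by (rule le[OF RI[OF that]])
  have zero: "\<phi> a = 0" if "\<And>a. Q a \<Longrightarrow> Q (- a)" "\<And>a. Q a \<Longrightarrow> \<phi> a \<le> 0" "Q a" for Q a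
    using that(2)[OF that(3)] that(2)[OF that(1)[OF that(3)]] linear_neg[OF \<phi>] by simp
  have skew: "\<phi> a = 0" if "re_part a = 0" for a
  proof (rule zero[of "\<lambda>a. re_part a = 0"])
    show "\<phi> a \<le> 0" if "re_part a = 0" for a
      \<comment> \<open>The positional arguments of \<open>bd\<close> are \<open>c\<close>,
        \<open>t\<close>, \<open>a\<close>, \<open>x\<close> in this order.\<close>
      using bd[of 0 0 a 0] that by (simp add: linear_0[OF lin] linear_0[OF linear_aut])
  qed (use that in \<open>simp_all add: linear_neg[OF linear_re_part]\<close>)
  have cob: "\<phi> a = 0" if "\<exists>x. a = x - \<alpha> x" for a
  proof (rule zero[of "\<lambda>a. \<exists>x. a = x - \<alpha> x"])
    show "\<exists>x. - a = x - \<alpha> x" if ex: "\<exists>x. a = x - \<alpha> x" for a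
    proof -
      obtain x where "a = x - \<alpha> x" using ex by blast
      then have "- a = (- x) - \<alpha> (- x)" by (simp add: linear_neg[OF linear_aut])
      then show ?thesis by blast
    qed
    show "\<phi> a \<le> 0" if ex: "\<exists>x. a = x - \<alpha> x" for a
    proof -
      obtain x where "a = x - \<alpha> x" using ex by blast
      \<comment> \<open>This witness makes the second element in \<open>?P\<close> equal to
        \<open>0\<close>, because \<alpha> commutes with \<open>re_part\<close>.\<close>
      then show ?thesis using bd[of 0 0 a "- re_part x"]
        by (simp add: linear_0[OF lin] linear_neg[OF linear_aut] linear_diff[OF linear_re_part] aut_re_part)
    qed
  qed (rule that)
  show ?thesis
  proof (rule that[OF \<phi>])
    show "\<phi> (cstar x) = \<phi> x" for x
    proof -
      have "\<phi> (cstar x - x) = 0"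
        by (rule skew) (simp add: linear_diff[OF linear_re_part] re_part_cstar)
      then show ?thesis by (simp add: linear_diff[OF \<phi>])
    qed
    show "\<phi> (\<alpha> x) = \<phi> x" for x
      using cob[OF exI[of _ x], OF refl] by (simp add: linear_diff[OF \<phi>])
    fix c :: 'a assume c: "pos c"
    then have re: "re_part (- c) = - c"
      by (simp add: linear_neg[OF linear_re_part] re_part_selfadjoint pos_selfadjoint)
    show "0 \<le> \<phi> c"
      using bd[of 0 0 "- c" 0] c re by (simp add: linear_0[OF lin] linear_0[OF linear_aut] linear_neg[OF \<phi>])
    show "G c \<le> \<phi> c"
      using bd[of c 0 "- c" 0] c re by (simp add: linear_0[OF linear_aut] linear_neg[OF \<phi>])
  qed
qed

text \<open>The hermitian real part \<open>G\<close> of \<open>g\<close> is a difference of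
  invariant positive functionals \<phi> and \<psi>. They agree on the fixed points, in particular at
  \<open>1\<close>, so after division by \<open>\<phi> 1\<close> both are state extensions of one
  state, and (ii) makes them equal.\<close>

lemma invariant_functional_zero_selfadjoint:
  assumes P2: "\<And>f. state_on Fix f \<Longrightarrow>
    \<exists>!g. state_on UNIV g \<and> g \<circ> \<alpha> = g \<and> (\<forall>x\<in>Fix. g x = f x)"
    and g: "bounded_functional_on UNIV g" "g \<circ> \<alpha> = g" "\<And>x. x \<in> Fix \<Longrightarrow> g x = 0"
    and h: "cstar h = h"
  shows "Re (g h) = 0"
proof -
  interpret g: bounded_linear g by (rule bounded_linear_of_bounded_functional[OF g(1)])
  define G where "G x = Re (g (re_part x))" for x
  have linG: "linear G"
    by (rule linearI)
      (simp_all add: G_def linear_add[OF linear_re_part] linear_scale[OF linear_re_part] g.add g.scaleR)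
  have invG: "G (\<alpha> x) = G x" for x
    using fun_cong[OF g(2), of "re_part x"] by (simp add: G_def flip: aut_re_part)
  have starG: "G (cstar x) = G x" for x by (simp add: G_def re_part_cstar)
  have fixG: "G x = 0" if "x \<in> Fix" for x using that by (simp add: G_def g(3) re_part_in_Fix)
  obtain K where K: "\<And>x. norm (g x) \<le> norm x * K" "K \<ge> 0" using g.nonneg_bounded by blast
  have boundG: "G x \<le> K * norm x" for x
  proof -
    have "G x \<le> norm (g (re_part x))" unfolding G_def by (rule complex_Re_le_cmod)
    also have "\<dots> \<le> norm (re_part x) * K" by (rule K)
    also have "\<dots> \<le> norm x * K" by (intro mult_right_mono norm_re_part_le K)
    finally show ?thesis by (simp add: mult.commute)
  qed
  obtain \<phi> where \<phi>: "linear \<phi>" and star: "\<And>x. \<phi> (cstar x) = \<phi> x" and inv: "\<And>x. \<phi> (\<alpha> x) = \<phi> x"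
    and pos: "\<And>c. pos c \<Longrightarrow> 0 \<le> \<phi> c" and dom: "\<And>c. pos c \<Longrightarrow> G c \<le> \<phi> c"
    using invariant_positive_majorant[OF linG boundG K(2) invG] by blast
  define \<psi> where "\<psi> x = \<phi> x - G x" for x
  have \<psi>: "linear \<psi>" unfolding \<psi>_def by (intro linear_compose_sub \<phi> linG)
  have pos': "0 \<le> \<psi> c" if "pos c" for c using dom[OF that] by (simp add: \<psi>_def)
  have one: "\<psi> 1 = \<phi> 1" by (simp add: \<psi>_def fixG one_in_Fix)
  have "\<phi> h = \<psi> h"
  proof (cases "\<phi> 1 = 0")
    case True
    \<comment> \<open>Normalisation is impossible here, but a positive functional that vanishes at
      \<open>1\<close> vanishes on all selfadjoint elements.\<close>
    have "\<theta> h = 0" if "linear \<theta>" "\<And>c. pos c \<Longrightarrow> 0 \<le> \<theta> c" "\<theta> 1 = 0" for \<theta> :: "'a \<Rightarrow> real"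
      using positive_functional_le[OF that(1,2) h] positive_functional_le[OF that(1,2), of "- h"] h that(3)
      by (simp add: linear_neg[OF that(1)])
    from this[OF \<phi> pos] this[OF \<psi> pos'] show ?thesis using True one by simp
  next
    case False
    then have k: "\<phi> 1 > 0" using pos[OF pos_scaleR_one[of 1]] by simp
    define \<Phi> where "\<Phi> \<theta> = complexify (\<lambda>x. \<theta> x / \<phi> 1)" for \<theta> :: "'a \<Rightarrow> real"
    have state: "state_on S (\<Phi> \<theta>)"
      if "linear \<theta>" "\<And>x. \<theta> (cstar x) = \<theta> x" "\<And>c. pos c \<Longrightarrow> 0 \<le> \<theta> c" "\<theta> 1 = \<phi> 1" "1 \<in> S" for \<theta> S
      unfolding \<Phi>_def using that k
      by (intro state_on_complexify linearI)
        (simp_all add: linear_add[OF that(1)] linear_scale[OF that(1)] add_divide_distrib)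
    have inv\<Phi>: "\<Phi> \<theta> \<circ> \<alpha> = \<Phi> \<theta>" if "\<And>x. \<theta> (\<alpha> x) = \<theta> x" for \<theta>
      by (simp add: fun_eq_iff \<Phi>_def complexify_def that flip: aut_cscale)
    have "\<Phi> \<psi> x = \<Phi> \<phi> x" if "x \<in> Fix" for x
      using fixG[OF that] fixG[OF cscale_in_Fix[OF that]] by (simp add: \<Phi>_def complexify_def \<psi>_def)
    moreover have "state_on Fix (\<Phi> \<phi>)" by (rule state) (use \<phi> star pos one_in_Fix in auto)
    moreover have "state_on UNIV (\<Phi> \<phi>)" by (rule state) (use \<phi> star pos in auto)
    moreover have "state_on UNIV (\<Phi> \<psi>)"
      by (rule state) (use \<psi> star starG pos' one in \<open>auto simp: \<psi>_def\<close>)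
    moreover have "\<Phi> \<phi> \<circ> \<alpha> = \<Phi> \<phi>" "\<Phi> \<psi> \<circ> \<alpha> = \<Phi> \<psi>" by (intro inv\<Phi>; simp add: \<psi>_def inv invG)+
    ultimately have "\<Phi> \<phi> = \<Phi> \<psi>" using P2[of "\<Phi> \<phi>"] by blast
    then have "\<Phi> \<phi> h = \<Phi> \<psi> h" by simp
    then show ?thesis using k by (simp add: \<Phi>_def complexify_def)
  qed
  then show ?thesis using h by (simp add: \<psi>_def G_def re_part_selfadjoint)
qed

lemma dense_of_unique_state_extension:
  assumes P2: "\<And>f. state_on Fix f \<Longrightarrow>
    \<exists>!g. state_on UNIV g \<and> g \<circ> \<alpha> = g \<and> (\<forall>x\<in>Fix. g x = f x)"
  shows "closure {x + y | x y. x \<in> Fix \<and> y \<in> Cob} = UNIV"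
proof (rule ccontr)
  assume "closure {x + y | x y. x \<in> Fix \<and> y \<in> Cob} \<noteq> UNIV"
  then obtain g z where g: "bounded_functional_on UNIV g" "g \<circ> \<alpha> = g" "\<And>x. x \<in> Fix \<Longrightarrow> g x = 0" "g z \<noteq> 0"
    by (rule annihilating_functional) blast
  have lin: "clinear_on UNIV g" using g(1) by (simp add: bounded_functional_on_def)
  have sa: "g h = 0" if h: "cstar h = h" for h
  proof -
    obtain K where K: "\<And>x. cmod (g x) \<le> K * norm x"
      using g(1) by (auto simp: bounded_functional_on_def bounded_on_def)
    \<comment> \<open>The preceding lemma only sees real parts; applied to \<open>\<i> * g\<close>
      it also removes the imaginary part of \<open>g h\<close>.\<close>
    have "bounded_functional_on UNIV (\<lambda>x. \<i> * g x)"
      using lin K by (auto simp: bounded_functional_on_def bounded_on_def clinear_on_def norm_mult algebra_simps)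
    moreover have "(\<lambda>x. \<i> * g x) \<circ> \<alpha> = (\<lambda>x. \<i> * g x)" using g(2) by (auto simp: fun_eq_iff)
    ultimately have "Re (\<i> * g h) = 0"
      using g(3) h by (intro invariant_functional_zero_selfadjoint[OF P2]) simp_all
    moreover have "Re (g h) = 0" by (rule invariant_functional_zero_selfadjoint[OF P2 g(1-3) h])
    ultimately show ?thesis by (simp add: complex_eq_iff)
  qed
  have "g z = g (re_part z + \<i> *\<^sub>C re_part ((- \<i>) *\<^sub>C z))" by (subst re_part_decomp[of z]) (rule refl)
  also have "\<dots> = g (re_part z) + \<i> * g (re_part ((- \<i>) *\<^sub>C z))" using lin by (simp add: clinear_on_def)
  also have "\<dots> = 0" by (simp add: sa)
  finally show False using g(4) by simp
qed

lemma dense_of_decomposition: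
  assumes "{x + y | x y. x \<in> Fix \<and> y \<in> closure Cob} = UNIV"
  shows "closure {x + y | x y. x \<in> Fix \<and> y \<in> Cob} = UNIV"
proof -
  have "a \<in> closure {x + y | x y. x \<in> Fix \<and> y \<in> Cob}" for a
  proof -
    have "a \<in> {x + y | x y. x \<in> Fix \<and> y \<in> closure Cob}" unfolding assms by (rule UNIV_I)
    then obtain x y where a: "a = x + y" "x \<in> Fix" "y \<in> closure Cob" by blast
    have "\<exists>s. (\<forall>n. s n \<in> Cob) \<and> s \<longlonglongrightarrow> y" using a(3) unfolding closure_sequential .
    then obtain s where s: "\<And>n. s n \<in> Cob" "s \<longlonglongrightarrow> y" by metis
    have "(\<lambda>n. x + s n) \<longlonglongrightarrow> a" unfolding a(1) by (intro tendsto_intros s)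
    moreover have "x + s n \<in> {x + y | x y. x \<in> Fix \<and> y \<in> Cob}" for n using a(2) s(1)[of n] by blast
    ultimately show ?thesis unfolding closure_sequential by (intro exI[of _ "\<lambda>n. x + s n"]) simp
  qed
  then show ?thesis by blast
qed

end

theorem theorem3p2:
  fixes \<alpha> :: "'a::cstar_algebra \<Rightarrow> 'a"
  assumes aut: "star_automorphism \<alpha>"
  defines "Fix \<equiv> fixed_points \<alpha>"
      and "D \<equiv> range (\<lambda>a. a - \<alpha> a)"
  defines "P1 \<equiv> (\<forall>f. bounded_functional_on Fix f \<longrightarrow>
                (\<exists>!g. bounded_functional_on UNIV g \<and> g \<circ> \<alpha> = g \<and> (\<forall>x\<in>Fix. g x = f x)))"
      and "P2 \<equiv> (\<forall>f. state_on Fix f \<longrightarrow>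
                (\<exists>!g. state_on UNIV g \<and> g \<circ> \<alpha> = g \<and> (\<forall>x\<in>Fix. g x = f x)))"
      and "P3 \<equiv> (closure {x + y | x y. x \<in> Fix \<and> y \<in> D} = UNIV)"
      and "P4 \<equiv> (\<forall>a. convergent (ergodic_avg \<alpha> a))"
      and "P5 \<equiv> ({x + y | x y. x \<in> Fix \<and> y \<in> closure D} = UNIV)"
  shows "(P1 \<longleftrightarrow> P2) \<and> (P2 \<longleftrightarrow> P3) \<and> (P3 \<longleftrightarrow> P4) \<and> (P4 \<longleftrightarrow> P5) \<and>
         (P1 \<longrightarrow> (\<exists>!E. conditional_expectation Fix E \<and> E \<circ> \<alpha> = E) \<and>
                 (\<forall>E. conditional_expectation Fix E \<and> E \<circ> \<alpha> = E \<longrightarrow>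
                      (\<forall>a. ergodic_avg \<alpha> a \<longlonglongrightarrow> E a)))"
proof -
  interpret cstar_automorphism \<alpha> by unfold_locales (rule aut)
  have 13: "P1 \<Longrightarrow> P3" unfolding P1_def P3_def Fix_def D_def
    by (rule dense_of_unique_bounded_extension) blast
  have 23: "P2 \<Longrightarrow> P3" unfolding P2_def P3_def Fix_def D_def
    by (rule dense_of_unique_state_extension) blast
  have 34: "P3 \<Longrightarrow> P4" unfolding P3_def P4_def Fix_def D_def
    using convergent_avg_of_dense by blast
  have 45: "P4 \<Longrightarrow> P5" unfolding P4_def P5_def Fix_def D_def
    by (rule decomposition) blast
  have 53: "P5 \<Longrightarrow> P3" unfolding P5_def P3_def Fix_def D_def
    by (rule dense_of_decomposition)
  have 41: "P4 \<Longrightarrow> P1" unfolding P4_def P1_def Fix_def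
    using unique_bounded_extension by blast
  have 42: "P4 \<Longrightarrow> P2" unfolding P4_def P2_def Fix_def
    using unique_state_extension by blast
  have "(\<exists>!E. conditional_expectation Fix E \<and> E \<circ> \<alpha> = E) \<and>
      (\<forall>E. conditional_expectation Fix E \<and> E \<circ> \<alpha> = E \<longrightarrow> (\<forall>a. ergodic_avg \<alpha> a \<longlonglongrightarrow> E a))" if P4
  proof -
    have conv: "\<And>a. convergent (ergodic_avg \<alpha> a)" using that by (simp add: P4_def)
    have "conditional_expectation Fix mean \<and> mean \<circ> \<alpha> = mean"
      using conditional_expectation_mean[OF conv] mean_aut[OF conv] by (auto simp: Fix_def)
    moreover have eq: "E = mean" if "conditional_expectation Fix E \<and> E \<circ> \<alpha> = E" for E
      using invariant_conditional_expectation_eq_mean[OF conv] that by (auto simp: Fix_def)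
    ultimately have "\<exists>!E. conditional_expectation Fix E \<and> E \<circ> \<alpha> = E" by (intro ex1I[of _ mean])
    moreover have "ergodic_avg \<alpha> a \<longlonglongrightarrow> E a" if "conditional_expectation Fix E \<and> E \<circ> \<alpha> = E" for E a
      using avg_tendsto_mean[OF conv, of a] by (simp add: eq[OF that])
    ultimately show ?thesis by blast
  qed
  then show ?thesis using 13 23 34 45 53 41 42 by blast
qed

end
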